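(* Consider the decoupled linear hyperbolic system with random initial data $$\begin{cases}\partial_t u+c_1(x)\,\partial_x u=0,\\ \partial_t v+c_2(x)\,\partial_x v=0,\\ u(0,x;\omega)=u_{(0,x)}(\omega),\quad v(0,x;\omega)=v_{(0,x)}(\omega).\end{cases}$$ Let $\phi_{t,x,y}$ be the two-point statistics, defined for every measurable $A\subseteq\mathbb{R}^2$ by $$\phi_{t,x,y}(A)=\mu\left(\left\{\omega\in\Omega:\ (u(t,x;\omega),v(t,y;\omega))^\top\in A\right\}\right),$$ and let $f(t,x,y,U,V)$ be its probability density function. If $f(0,x,y,\cdot,\cdot)=f_0(x,y,\cdot,\cdot)\in L^1(\mathbb{R}^2)$, then $$\partial_t f(t,x,y,U,V)+c_1(x)\,\partial_x f+c_2(y)\,\partial_y f=0$$ for all $t\ge0$ and $(x,y)\in\mathbb{R}^2$, with initial condition $f(0,x,y,U,V)=f_0(x,y,U,V)$.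
   Context: $\Omega\subseteq\mathbb{R}^d$ is equipped with a Borel probability measure $\mu$; for each $x\in\mathbb{R}$ the initial data $u_{(0,x)},v_{(0,x)}:\Omega\to\mathbb{R}$ are measurable. The decoupled system arises from a $2\times2$ system $\vec z_t+D(x)\vec z_x=0$, where $x\mapsto D(x)$ is smooth and each $D(x)$ is real diagonalizable, under the assumption that $D(x)$ admits an $x$-independent diagonalization: there is an invertible matrix $P$ with $PD(x)P^{-1}=\mathrm{diag}(c_1(x),c_2(x))$ for all $x\in\mathbb{R}$, and $(u,v)^\top=P\vec z$.
   Formalization: The equation for f is proved pointwise only where f is differentiable in (t,x,y), for almost every (U,V), and otherwise in the sense of distributions, since a density need not be differentiable; u, v are C^1 classical solutions, measurable in ω, and f=f_0 at t=0 holds for a.e. (U,V). *)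

theory Defs
  imports "HOL-Probability.Probability"
begin

definition smooth :: "(real \<Rightarrow> real) \<Rightarrow> bool" where
  "smooth g \<longleftrightarrow> (\<forall>n x. ((deriv ^^ n) g) differentiable (at x))"

definition diag2 :: "real \<Rightarrow> real \<Rightarrow> real^2^2" where
  "diag2 a b = vector [vector [a, 0], vector [0, b]]"

definition C1_on :: "'a::euclidean_space set \<Rightarrow> ('a \<Rightarrow> real) \<Rightarrow> bool" where
  "C1_on S g \<longleftrightarrow>
     (\<exists>g' :: 'a \<Rightarrow> 'a \<Rightarrow>\<^sub>L real. continuous_on S g' \<and>
        (\<forall>p\<in>S. (g has_derivative blinfun_apply (g' p)) (at p within S)))"

text \<open>Time derivatives are taken within \<open>{0..}\<close>; they are one-sided at \<open>t = 0\<close>.\<close>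

definition classical_solution1 ::
  "(real \<Rightarrow> real) \<Rightarrow> (real \<Rightarrow> real) \<Rightarrow> (real \<Rightarrow> real \<Rightarrow> real) \<Rightarrow> bool" where
  "classical_solution1 c w0 w \<longleftrightarrow>
     C1_on ({0..} \<times> UNIV) (\<lambda>(t, x). w t x) \<and>
     (\<forall>t\<ge>0. \<forall>x. \<exists>wt wx.
        ((\<lambda>s. w s x) has_real_derivative wt) (at t within {0..}) \<and>
        ((\<lambda>a. w t a) has_real_derivative wx) (at x) \<and>
        wt + c x * wx = 0) \<and>
     (\<forall>x. w 0 x = w0 x)"

definition transport_eq_at ::
  "(real \<Rightarrow> real) \<Rightarrow> (real \<Rightarrow> real) \<Rightarrow> (real \<Rightarrow> real \<Rightarrow> real \<Rightarrow> real) \<Rightarrow> real \<Rightarrow> real \<Rightarrow> real \<Rightarrow> bool" where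
  "transport_eq_at c1 c2 g t x y \<longleftrightarrow>
     (\<exists>gt gx gy.
        ((\<lambda>s. g s x y) has_real_derivative gt) (at t within {0..}) \<and>
        ((\<lambda>a. g t a y) has_real_derivative gx) (at x) \<and>
        ((\<lambda>b. g t x b) has_real_derivative gy) (at y) \<and>
        gt + c1 x * gx + c2 y * gy = 0)"

definition two_point_statistics ::
  "'w measure \<Rightarrow> (real \<Rightarrow> real \<Rightarrow> 'w \<Rightarrow> real) \<Rightarrow> (real \<Rightarrow> real \<Rightarrow> 'w \<Rightarrow> real) \<Rightarrow>
   real \<Rightarrow> real \<Rightarrow> real \<Rightarrow> (real \<times> real) measure" where
  "two_point_statistics \<mu> u v t x y = distr \<mu> borel (\<lambda>\<omega>. (u t x \<omega>, v t y \<omega>))"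

definition is_pdf :: "(real \<times> real) measure \<Rightarrow> (real \<Rightarrow> real \<Rightarrow> real) \<Rightarrow> bool" where
  "is_pdf \<phi> g \<longleftrightarrow>
     (\<lambda>(U, V). g U V) \<in> borel_measurable borel \<and> (\<forall>U V. 0 \<le> g U V) \<and>
     \<phi> = density lborel (\<lambda>(U, V). ennreal (g U V))"

text \<open>Test functions are the restrictions to \<open>t \<ge> 0\<close> of compactly supported \<open>C\<^sup>1\<close> functions
  of \<open>(t, x, y, U, V)\<close>. They need not vanish at \<open>t = 0\<close>, and they include the restrictions of
  all \<open>C\<^sup>\<infinity>\<close> functions with compact support.\<close>

definition test_function :: "(real \<times> real \<times> real \<times> real \<times> real \<Rightarrow> real) \<Rightarrow> bool" where
  "test_function \<psi> \<longleftrightarrow> C1_on UNIV \<psi> \<and> compact (closure {p. \<psi> p \<noteq> 0})"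

definition adjoint_transport ::
  "(real \<Rightarrow> real) \<Rightarrow> (real \<Rightarrow> real) \<Rightarrow> (real \<times> real \<times> real \<times> real \<times> real \<Rightarrow> real) \<Rightarrow>
   real \<Rightarrow> real \<Rightarrow> real \<Rightarrow> real \<Rightarrow> real \<Rightarrow> real" where
  "adjoint_transport c1 c2 \<psi> t x y U V =
     deriv (\<lambda>s. \<psi> (s, x, y, U, V)) t +
     deriv (\<lambda>a. c1 a * \<psi> (t, a, y, U, V)) x +
     deriv (\<lambda>b. c2 b * \<psi> (t, x, b, U, V)) y"

text \<open>The distributional form of \<open>g\<^sub>t + c\<^sub>1(x) g\<^sub>x + c\<^sub>2(y) g\<^sub>y = 0\<close>, \<open>g(0) = g\<^sub>0\<close>: multiply by a
  test function \<open>\<psi>\<close> and integrate by parts in \<open>t\<close>, \<open>x\<close>, \<open>y\<close> over \<open>t \<ge> 0\<close>.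
  The \<open>(U, V)\<close>-integral is the inner one because a density is only determined for each
  \<open>(t, x, y)\<close> up to a null set of \<open>(U, V)\<close>, so \<open>g\<close> need not be jointly measurable in all five
  variables; where it is, this is the usual five-dimensional integral. The integrability
  clauses exclude the default value 0 of a non-existing Bochner integral.\<close>

definition weak_transport_solution ::
  "(real \<Rightarrow> real) \<Rightarrow> (real \<Rightarrow> real) \<Rightarrow> (real \<Rightarrow> real \<Rightarrow> real \<Rightarrow> real \<Rightarrow> real) \<Rightarrow>
   (real \<Rightarrow> real \<Rightarrow> real \<Rightarrow> real \<Rightarrow> real \<Rightarrow> real) \<Rightarrow> bool" where
  "weak_transport_solution c1 c2 g0 g \<longleftrightarrow>
     (\<forall>\<psi>. test_function \<psi> \<longrightarrow>
        (let
           J = (\<lambda>(t, x, y). LINT (U, V)|lborel. g t x y U V * adjoint_transport c1 c2 \<psi> t x y U V);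
           J0 = (\<lambda>(x, y). LINT (U, V)|lborel. g0 x y U V * \<psi> (0, x, y, U, V))
         in
           (\<forall>t\<ge>0. \<forall>x y. integrable lborel (\<lambda>(U, V). g t x y U V * adjoint_transport c1 c2 \<psi> t x y U V)) \<and>
           (\<forall>x y. integrable lborel (\<lambda>(U, V). g0 x y U V * \<psi> (0, x, y, U, V))) \<and>
           set_integrable lborel ({0..} \<times> UNIV) J \<and>
           integrable lborel J0 \<and>
           (LINT p:{0..} \<times> UNIV|lborel. J p) + (LINT q|lborel. J0 q) = 0))"

end

theory Submission
  imports Defs
begin

text \<open>
  Each realization of \<open>u\<close> is constant along local characteristics \<open>X' = c\<^sub>1(X)\<close> and each realization
  of \<open>v\<close> along \<open>Y' = c\<^sub>2(Y)\<close>. Hence the law of \<open>(u(t + s, X(s)), v(t + s, Y(s)))\<close> does not depend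
  on \<open>s\<close>, and wherever its density is differentiable its derivative in the direction
  \<open>(1, c\<^sub>1(x), c\<^sub>2(y))\<close> vanishes. For a \<open>C\<^sup>1\<close> density it suffices to check this at rational points.

  For the weak form no characteristics are used. If \<open>\<psi>\<close> is a test function, then
  \<open>h(t, x, y) = \<psi>(t, x, y, u(t, x), v(t, y))\<close> is \<open>C\<^sup>1\<close> with bounded support
      for each realization, and
  by the equations for \<open>u\<close> and \<open>v\<close> the adjoint expression evaluated at \<open>(u, v)\<close> is the divergence
  \<open>h\<^sub>t + (c\<^sub>1 h)\<^sub>x + (c\<^sub>2 h)\<^sub>y\<close>, whose integral is minus the integral of \<open>h(0, x, y)\<close>. Taking
  expectations and applying Fubini's theorem gives the claim; continuity of \<open>u\<close> and \<open>v\<close> in \<open>(t, x)\<close>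
  provides the joint measurability that this requires.
\<close>

subsection \<open>Characteristics\<close>

text \<open>The sets \<open>S\<close> and \<open>T\<close> let one chain rule serve both for
  two-sided derivatives in x and y and for the one-sided time derivative at t = 0.\<close>

lemma has_real_derivative_along_curve:
  fixes F :: "'a::real_normed_vector \<Rightarrow> real"
  assumes F: "(F has_derivative F') (at (\<gamma> t) within T)"
    and \<gamma>: "(\<gamma> has_vector_derivative d) (at t within S)"
    and "\<gamma> ` S \<subseteq> T"
  shows "((\<lambda>s. F (\<gamma> s)) has_real_derivative F' d) (at t within S)"
  using vector_derivative_diff_chain_within[OF \<gamma> has_derivative_subset[OF F assms(3)]]
  by (simp add: o_def has_real_derivative_iff_has_vector_derivative)

lemma C1_on_imp_continuous_on:
  assumes "C1_on S g" shows "continuous_on S g"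
proof -
  obtain g' where "\<And>p. p \<in> S \<Longrightarrow> (g has_derivative blinfun_apply (g' p)) (at p within S)"
    using assms unfolding C1_on_def by blast
  then show ?thesis by (rule has_derivative_continuous_on)
qed

text \<open>The right-hand neighbourhoods of \<open>t\<close> lie in the half-line, also for t = 0;
  this makes one-sided time derivatives unique.\<close>

lemma at_within_atLeast_0_not_bot:
  assumes "0 \<le> (t::real)" shows "at t within {0..} \<noteq> bot"
proof -
  have "at t within {t<..} \<noteq> bot" by (simp add: trivial_limit_at_right_real)
  moreover have "at t within {t<..} \<le> at t within {0..}" using assms by (intro at_le) auto
  ultimately show ?thesis by (metis bot.extremum_unique)
qed

lemma real_derivative_unique_within_atLeast_0:
  assumes "0 \<le> t" "(f has_real_derivative a) (at t within {0..})"
    "(f has_real_derivative b) (at t within {0..})"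
  shows "a = b"
  using vector_derivative_unique_within[OF at_within_atLeast_0_not_bot[OF assms(1)]] assms(2,3)
  by (simp add: has_real_derivative_iff_has_vector_derivative)

text \<open>The partial derivatives in \<open>classical_solution1\<close> are given separately from
  the total derivative in \<open>C1_on\<close>. Uniqueness of derivatives identifies them with the
  values of \<open>w'\<close> on the unit vectors, so the equation becomes a linear relation for
  \<open>w'\<close>, the form that the chain rule needs.\<close>

lemma classical_solution1_derivative:
  assumes "classical_solution1 c w0 w"
  obtains w' :: "real \<times> real \<Rightarrow> (real \<times> real) \<Rightarrow>\<^sub>L real"
  where "continuous_on ({0..} \<times> UNIV) w'"
    and "\<And>t x. 0 \<le> t \<Longrightarrow>
      ((\<lambda>(t, x). w t x) has_derivative blinfun_apply (w' (t, x))) (at (t, x) within {0..} \<times> UNIV)"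
    and "\<And>t x. 0 \<le> t \<Longrightarrow> w' (t, x) (1, 0) + c x * w' (t, x) (0, 1) = 0"
proof -
  obtain w' where cont: "continuous_on ({0..} \<times> UNIV) w'"
    and deriv: "\<And>p. p \<in> {0..} \<times> UNIV \<Longrightarrow>
      ((\<lambda>(t, x). w t x) has_derivative blinfun_apply (w' p)) (at p within {0..} \<times> UNIV)"
    using assms unfolding classical_solution1_def C1_on_def by blast
  have "w' (t, x) (1, 0) + c x * w' (t, x) (0, 1) = 0" if t: "0 \<le> t" for t x
  proof -
    obtain wt wx where wt: "((\<lambda>s. w s x) has_real_derivative wt) (at t within {0..})"
      and wx: "((\<lambda>a. w t a) has_real_derivative wx) (at x)" and eq: "wt + c x * wx = 0"
      using assms t unfolding classical_solution1_def by blast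
    have d: "((\<lambda>(t, x). w t x) has_derivative blinfun_apply (w' (t, x)))
        (at (t, x) within {0..} \<times> UNIV)"
      using deriv[of "(t, x)"] t by simp
    have "((\<lambda>s. (s, x)) has_vector_derivative (1, 0)) (at t within {0..})"
      by (auto intro!: derivative_eq_intros)
    from has_real_derivative_along_curve[OF _ this, OF d]
    have "((\<lambda>s. w s x) has_real_derivative w' (t, x) (1, 0)) (at t within {0..})" by auto
    then have "w' (t, x) (1, 0) = wt"
      using real_derivative_unique_within_atLeast_0[OF t _ wt] by blast
    moreover have "((\<lambda>a. (t, a)) has_vector_derivative (0, 1)) (at x)"
      by (auto intro!: derivative_eq_intros)
    from has_real_derivative_along_curve[OF _ this, OF d] t
    have "((\<lambda>a. w t a) has_real_derivative w' (t, x) (0, 1)) (at x)" by auto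
    then have "w' (t, x) (0, 1) = wx"
      using DERIV_unique[OF _ wx] by blast
    ultimately show ?thesis using eq by simp
  qed
  then show ?thesis using that cont deriv by auto
qed

text \<open>Separation of variables: where \<open>c\<close> does not vanish, \<open>X\<close> inverts an antiderivative of
  \<open>1 / c\<close>. Uniqueness and global existence, which may fail, are not needed.\<close>

lemma local_characteristic:
  assumes "continuous_on UNIV (c :: real \<Rightarrow> real)"
  obtains \<epsilon> X where "0 < \<epsilon>" "X 0 = x"
    "\<And>s. s \<in> {0..\<epsilon>} \<Longrightarrow> (X has_real_derivative c (X s)) (at s)"
proof (cases "c x = 0")
  case True
  \<comment> \<open>At a zero of \<open>c\<close> the constant curve is a characteristic, on an
    interval of any length.\<close>
  then show ?thesis by (intro that[of 1 "\<lambda>_. x"]) auto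
next
  case False
  have "isCont c x" using assms by (simp add: continuous_on_eq_continuous_at)
  \<comment> \<open>With this tolerance \<open>c\<close> keeps the sign of \<open>c x\<close> at
    distance less than \<open>\<delta>\<close> from \<open>x\<close>.\<close>
  then obtain \<delta> where \<delta>: "0 < \<delta>" and close: "\<And>z. \<bar>z - x\<bar> < \<delta> \<Longrightarrow> \<bar>c z - c x\<bar> < \<bar>c x\<bar>"
    using False unfolding continuous_at_eps_delta dist_real_def by (meson zero_less_abs_iff)
  \<comment> \<open>\<open>I\<close> is closed for the antiderivative, \<open>J\<close> open for the
    inverse function theorem. As \<open>x\<close> is interior to \<open>J\<close>, the inverse is
    differentiable from both sides even at s = 0.\<close>
  define I where "I = {x - \<delta> / 2..x + \<delta> / 2}"
  define J where "J = {x - \<delta> / 2<..<x + \<delta> / 2}"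
  have sign: "0 < c z / c x" if "z \<in> I" for z
  proof -
    have "\<bar>z - x\<bar> < \<delta>" using that \<delta> unfolding I_def by auto
    then show ?thesis using close[of z] False
      by (auto simp: zero_less_divide_iff abs_if split: if_splits)
  qed
  then have nz: "c z \<noteq> 0" if "z \<in> I" for z using that by fastforce
  have "continuous_on I (\<lambda>z. inverse (c z))"
    using nz continuous_on_subset[OF assms, of I] by (intro continuous_intros) auto
  then obtain G0 where G0: "\<And>z. z \<in> I \<Longrightarrow> (G0 has_vector_derivative inverse (c z)) (at z within I)"
    using antiderivative_continuous unfolding I_def by blast
  \<comment> \<open>Normalized to G x = 0, so that the inverse is at \<open>x\<close> at time
    0.\<close>
  define G where "G z = G0 z - G0 x" for z
  have "continuous_on I G0"
    using G0 has_vector_derivative_continuous unfolding continuous_on_eq_continuous_within by blast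
  then have contG: "continuous_on I G"
    unfolding G_def by (intro continuous_intros)
  have dG: "(G has_real_derivative inverse (c z)) (at z)" if "z \<in> J" for z
  proof -
    have "z \<in> interior I" using that by (simp add: I_def J_def)
    then have "(G0 has_vector_derivative inverse (c z)) (at z)"
      using G0[of z] interior_subset[of I] by (metis at_within_interior subsetD)
    then show ?thesis
      using has_vector_derivative_diff_const[of G0 "G0 x"]
      unfolding G_def has_real_derivative_iff_has_vector_derivative by simp
  qed
  have mvt: "\<exists>z\<in>I. G b - G a = (b - a) * inverse (c z)" if "a < b" "a \<in> J" "b \<in> J" for a b
  proof -
    have "\<And>z. a \<le> z \<Longrightarrow> z \<le> b \<Longrightarrow> (G has_real_derivative inverse (c z)) (at z)"
      using that dG by (auto simp: J_def)
    from MVT2[OF that(1) this] obtain z where "a < z" "z < b" "G b - G a = (b - a) * inverse (c z)"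
      by blast
    then show ?thesis using that by (intro bexI[of _ z]) (auto simp: J_def I_def)
  qed
  have inj: "inj_on G J"
  proof (rule linorder_inj_onI)
    fix a b assume "a < b" "a \<in> J" "b \<in> J"
    with mvt[of a b] nz show "G a \<noteq> G b" by fastforce
  qed auto
  \<comment> \<open>\<open>p\<close> lies on the side of \<open>x\<close> towards which the flow
    moves, which makes \<open>G p\<close> positive for either sign of \<open>c x\<close>; the offset
    \<delta> / 4 keeps it inside \<open>J\<close>.\<close>
  define p where "p = x + sgn (c x) * (\<delta> / 4)"
  have x: "x \<in> J" and p: "p \<in> J" using \<delta> by (auto simp: J_def p_def sgn_if)
  have Gp: "0 < G p"
  proof (cases "0 < c x")
    case True
    obtain z where z: "z \<in> I" "G p - G x = (p - x) * inverse (c z)"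
      using mvt[of x p] x p \<delta> True by (auto simp: p_def)
    moreover have "0 < c z" using sign[of z] z True by (auto simp: zero_less_divide_iff)
    moreover have "0 < p - x" using True \<delta> by (simp add: p_def)
    ultimately show ?thesis by (simp add: G_def)
  next
    case neg: False
    obtain z where z: "z \<in> I" "G x - G p = (x - p) * inverse (c z)"
      using mvt[of p x] x p \<delta> neg False by (auto simp: p_def sgn_if)
    moreover have "c z < 0" using sign[of z] z neg by (auto simp: zero_less_divide_iff)
    moreover have "0 < x - p" using neg False \<delta> by (simp add: p_def sgn_if)
    ultimately have "G x - G p < 0" by (simp add: mult_less_0_iff del: inverse_eq_divide)
    then show ?thesis by (simp add: G_def)
  qed
  \<comment> \<open>Intermediate values: the image of the interval \<open>J\<close> is connected and
    contains G x = 0 and \<open>G p\<close>.\<close>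
  have G_J: "s \<in> G ` J" if "s \<in> {0..G p}" for s
  proof -
    have "connected (G ` J)"
      using contG by (intro connected_continuous_image)
        (auto intro: continuous_on_subset simp: J_def I_def)
    then show ?thesis
      using connectedD_interval[of "G ` J" "G x" "G p" s] that x p by (auto simp: G_def)
  qed
  define X where "X = inv_into J G"
  show ?thesis
  proof (rule that[of "G p" X])
    show "0 < G p" by fact
    have "inv_into J G (G x) = x" by (rule inv_into_f_f[OF inj x])
    then show "X 0 = x" by (simp add: X_def G_def)
    fix s assume "s \<in> {0..G p}"
    then obtain z where z: "z \<in> J" "s = G z" using G_J by blast
    have Xs: "X s = z" using z inj by (simp add: X_def)
    \<comment> \<open>The inverse function theorem wants the derivative of \<open>G\<close> as an
      invertible linear map: multiplication by 1 / c z, with inverse multiplication by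
      \<open>c z\<close>.\<close>
    have "((\<lambda>y. y * inverse (c z)) \<circ> (\<lambda>y. y * c z)) = id"
        "((\<lambda>y. y * c z)) \<circ> (\<lambda>y. y * inverse (c z)) = id"
      using nz[of z] z by (auto simp: J_def I_def fun_eq_iff)
    moreover have "(X has_derivative (\<lambda>y. y * c z)) (at (G z))"
    proof (rule has_derivative_inverse_strong[where f = G and S = J and f' = "\<lambda>y. y * inverse (c z)"])
      show "open J" by (simp add: J_def)
      show "continuous_on J G" using contG by (auto intro: continuous_on_subset simp: J_def I_def)
      show "X (G y) = y" if "y \<in> J" for y using that inj by (simp add: X_def)
      show "(G has_derivative (\<lambda>y. y * inverse (c z))) (at z)"
        using dG[OF z(1)] by (simp add: has_field_derivative_def mult_commute_abs)
    qed (use z calculation in auto)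
    ultimately show "(X has_real_derivative c (X s)) (at s)"
      using Xs z by (simp add: has_field_derivative_def mult_commute_abs)
  qed
qed

text \<open>The derivative along the curve is that of \<open>w\<close> in direction (1, c (X r)),
  which splits by linearity into the left side of the equation. Running forward from
  \<open>t\<close> keeps all times nonnegative.\<close>

lemma classical_solution1_constant_along_characteristic:
  assumes w: "classical_solution1 c w0 w" and t: "0 \<le> t"
    and X: "\<And>s. s \<in> {0..\<epsilon>} \<Longrightarrow> (X has_real_derivative c (X s)) (at s)"
    and s: "s \<in> {0..\<epsilon>}"
  shows "w (t + s) (X s) = w t (X 0)"
proof -
  obtain w' :: "real \<times> real \<Rightarrow> (real \<times> real) \<Rightarrow>\<^sub>L real" where
    w': "\<And>t x. 0 \<le> t \<Longrightarrow>
      ((\<lambda>(t, x). w t x) has_derivative blinfun_apply (w' (t, x))) (at (t, x) within {0..} \<times> UNIV)"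
    and eq: "\<And>t x. 0 \<le> t \<Longrightarrow> w' (t, x) (1, 0) + c x * w' (t, x) (0, 1) = 0"
    using classical_solution1_derivative[OF w] by metis
  have "\<exists>k. \<forall>r\<in>{0..\<epsilon>}. w (t + r) (X r) = k"
  proof (rule has_field_derivative_zero_constant)
    fix r assume r: "r \<in> {0..\<epsilon>}"
    have "((\<lambda>r. (t + r, X r)) has_vector_derivative (1, c (X r))) (at r within {0..\<epsilon>})"
      using has_vector_derivative_at_within X[OF r, unfolded has_real_derivative_iff_has_vector_derivative]
      by (auto intro!: derivative_eq_intros)
    from has_real_derivative_along_curve[OF w' this] t r
    have "((\<lambda>r. w (t + r) (X r)) has_real_derivative w' (t + r, X r) (1, c (X r)))
        (at r within {0..\<epsilon>})"
      by (auto simp: image_subset_iff)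
    moreover have "(1, c (X r)) = (1, 0) + c (X r) *\<^sub>R (0, 1::real)" by simp
    then have "w' (t + r, X r) (1, c (X r)) = w' (t + r, X r) (1, 0) + c (X r) * w' (t + r, X r) (0, 1)"
      by (metis blinfun.add_right blinfun.scaleR_right real_scaleR_def)
    ultimately show "((\<lambda>r. w (t + r) (X r)) has_real_derivative 0) (at r within {0..\<epsilon>})"
      using eq[of "t + r" "X r"] t r by simp
  qed simp
  then obtain k where "\<And>r. r \<in> {0..\<epsilon>} \<Longrightarrow> w (t + r) (X r) = k" by blast
  from this[of s] this[of 0] s show ?thesis by simp
qed

subsection \<open>Densities along characteristics\<close>

text \<open>The difference quotients along \<open>r\<close> are all 0. Since the derivative is
  already known to exist, one sequence of times tending to 0 determines it.\<close>

lemma directional_derivative_eq_0: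
  fixes F :: "'a::real_normed_vector \<Rightarrow> real"
  assumes F: "(F has_derivative F') (at (\<gamma> 0) within T)"
    and \<gamma>: "(\<gamma> has_vector_derivative d) (at 0 within S)" "\<gamma> ` S \<subseteq> T"
    and r: "r \<longlonglongrightarrow> 0" "\<And>n. r n \<in> S - {0::real}" "\<And>n. F (\<gamma> (r n)) = F (\<gamma> 0)"
  shows "F' d = 0"
proof -
  have "((\<lambda>s. (F (\<gamma> s) - F (\<gamma> 0)) / (s - 0)) \<longlongrightarrow> F' d) (at 0 within S)"
    using has_real_derivative_along_curve[OF F \<gamma>] by (simp add: has_field_derivative_iff)
  moreover have "filterlim r (at 0 within S) sequentially"
    using r by (auto simp: filterlim_at)
  ultimately have "(\<lambda>n. (F (\<gamma> (r n)) - F (\<gamma> 0)) / (r n - 0)) \<longlonglongrightarrow> F' d"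
    by (rule filterlim_compose)
  then show ?thesis using r(3) by (simp add: LIMSEQ_const_iff)
qed

text \<open>Uniqueness of densities over a sigma-finite measure; nonnegativity turns equality in
  \<open>ennreal\<close> back into equality of reals.\<close>

lemma is_pdf_unique:
  assumes "is_pdf \<phi> g" "is_pdf \<phi> h"
  shows "AE (U, V) in lborel. g U V = h U V"
proof -
  have [measurable]: "(\<lambda>(U, V). g U V) \<in> borel_measurable borel" "(\<lambda>(U, V). h U V)
      \<in> borel_measurable borel"
    and nn: "\<And>U V. 0 \<le> g U V" "\<And>U V. 0 \<le> h U V"
    and "density lborel (\<lambda>(U, V). ennreal (g U V)) = density lborel (\<lambda>(U, V). ennreal (h U V))"
    using assms by (auto simp: is_pdf_def)
  then have "AE p in lborel. (case p of (U, V) \<Rightarrow> ennreal (g U V))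
      = (case p of (U, V) \<Rightarrow> ennreal (h U V))"
    by (subst (asm) sigma_finite_measure.density_unique_iff[OF sigma_finite_lborel])
        (simp_all add: split_beta')
  then show ?thesis
    by eventually_elim (auto simp: nn)
qed

text \<open>Rounding down to a dyadic grid has countably many values at each level and keeps
  nonnegative times nonnegative. It serves twice: to approximate by rational points, and to prove
  joint measurability of the solutions.\<close>

lemma dyadic_floor_tendsto: "(\<lambda>n. real_of_int \<lfloor>s * 2 ^ n\<rfloor> / 2 ^ n) \<longlonglongrightarrow> s"
proof (rule LIMSEQ_I)
  fix e :: real assume "0 < e"
  then obtain N where N: "(1 / 2) ^ N < e" using real_arch_pow_inv[of e "1 / 2"] by auto
  have "norm (real_of_int \<lfloor>s * 2 ^ n\<rfloor> / 2 ^ n - s) < e" if "N \<le> n" for n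
  proof -
    have "\<bar>real_of_int \<lfloor>s * 2 ^ n\<rfloor> - s * 2 ^ n\<bar> < 1" by linarith
    then have "\<bar>real_of_int \<lfloor>s * 2 ^ n\<rfloor> - s * 2 ^ n\<bar> / 2 ^ n < 1 / 2 ^ n"
      by (intro divide_strict_right_mono) auto
    moreover have "real_of_int \<lfloor>s * 2 ^ n\<rfloor> / 2 ^ n - s
        = (real_of_int \<lfloor>s * 2 ^ n\<rfloor> - s * 2 ^ n) / 2 ^ n"
      by (simp add: diff_divide_distrib)
    ultimately have "norm (real_of_int \<lfloor>s * 2 ^ n\<rfloor> / 2 ^ n - s) < (1 / 2) ^ n"
      by (simp add: power_one_over abs_divide)
    also have "\<dots> \<le> (1 / 2) ^ N" using that by (intro power_decreasing) auto
    finally show ?thesis using N by simp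
  qed
  then show "\<exists>N. \<forall>n\<ge>N. norm (real_of_int \<lfloor>s * 2 ^ n\<rfloor> / 2 ^ n - s) < e" by blast
qed

text \<open>The characteristics are deterministic, so one pair of curves serves for all
  realizations: the random pairs themselves coincide, and hence their laws.\<close>

lemma two_point_statistics_along_characteristics:
  assumes u: "\<And>\<omega>. \<omega> \<in> space \<mu> \<Longrightarrow> classical_solution1 c1 (\<lambda>x. u0 x \<omega>) (\<lambda>t x. u t x \<omega>)"
    and v: "\<And>\<omega>. \<omega> \<in> space \<mu> \<Longrightarrow> classical_solution1 c2 (\<lambda>x. v0 x \<omega>) (\<lambda>t x. v t x \<omega>)"
    and t: "0 \<le> t"
    and X: "\<And>s. s \<in> {0..\<epsilon>} \<Longrightarrow> (X has_real_derivative c1 (X s)) (at s)"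
    and Y: "\<And>s. s \<in> {0..\<epsilon>} \<Longrightarrow> (Y has_real_derivative c2 (Y s)) (at s)"
    and s: "s \<in> {0..\<epsilon>}"
  shows "two_point_statistics \<mu> u v (t + s) (X s) (Y s) = two_point_statistics \<mu> u v t (X 0) (Y 0)"
  unfolding two_point_statistics_def
proof (rule distr_cong)
  fix \<omega> assume \<omega>: "\<omega> \<in> space \<mu>"
  show "(u (t + s) (X s) \<omega>, v (t + s) (Y s) \<omega>) = (u t (X 0) \<omega>, v t (Y 0) \<omega>)"
    using classical_solution1_constant_along_characteristic[OF u[OF \<omega>] t X s]
      classical_solution1_constant_along_characteristic[OF v[OF \<omega>] t Y s] by simp
qed auto

text \<open>At each time the densities agree only up to a null set of \<open>(U, V)\<close>. Comparing them along a
  sequence of times keeps the exceptional set null and still determines the derivative.\<close>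

lemma AE_pdf_transport_direction:
  assumes u: "\<And>\<omega>. \<omega> \<in> space \<mu> \<Longrightarrow> classical_solution1 c1 (\<lambda>x. u0 x \<omega>) (\<lambda>t x. u t x \<omega>)"
    and v: "\<And>\<omega>. \<omega> \<in> space \<mu> \<Longrightarrow> classical_solution1 c2 (\<lambda>x. v0 x \<omega>) (\<lambda>t x. v t x \<omega>)"
    and c: "continuous_on UNIV c1" "continuous_on UNIV c2"
    and f: "\<And>t x y. 0 \<le> t \<Longrightarrow> is_pdf (two_point_statistics \<mu> u v t x y) (f t x y)"
    and t: "0 \<le> t"
  shows "AE (U, V) in lborel. \<forall>F'.
    ((\<lambda>(s, a, b). f s a b U V) has_derivative F') (at (t, x, y) within {0..} \<times> UNIV) \<longrightarrow>
    F' (1, c1 x, c2 y) = 0"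
proof -
  obtain \<epsilon>1 X where X: "0 < \<epsilon>1" "X 0 = x" "\<And>s. s \<in> {0..\<epsilon>1} \<Longrightarrow> (X has_real_derivative c1 (X s))
      (at s)"
    using local_characteristic[OF c(1)] by metis
  obtain \<epsilon>2 Y where Y: "0 < \<epsilon>2" "Y 0 = y" "\<And>s. s \<in> {0..\<epsilon>2} \<Longrightarrow> (Y has_real_derivative c2 (Y s))
      (at s)"
    using local_characteristic[OF c(2)] by metis
  define \<epsilon> where "\<epsilon> = min \<epsilon>1 \<epsilon>2"
  have \<epsilon>: "0 < \<epsilon>" and X': "\<And>s. s \<in> {0..\<epsilon>} \<Longrightarrow> (X has_real_derivative c1 (X s)) (at s)"
    and Y': "\<And>s. s \<in> {0..\<epsilon>} \<Longrightarrow> (Y has_real_derivative c2 (Y s)) (at s)"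
    using X Y by (auto simp: \<epsilon>_def)
  define r where "r n = \<epsilon> * inverse (real (Suc n))" for n
  have r: "r n \<in> {0..\<epsilon>}" "r n \<noteq> 0" for n
    using \<epsilon> by (auto simp: r_def field_simps)
  have r_lim: "r \<longlonglongrightarrow> 0"
    unfolding r_def using tendsto_mult_right_zero[OF LIMSEQ_inverse_real_of_nat] .
  have "AE p in lborel. \<forall>n. f (t + r n) (X (r n)) (Y (r n)) (fst p) (snd p) = f t x y (fst p) (snd p)"
  proof (subst AE_all_countable, rule allI)
    fix n
    have "is_pdf (two_point_statistics \<mu> u v t x y) (f (t + r n) (X (r n)) (Y (r n)))"
      using f[of "t + r n" "X (r n)" "Y (r n)"] t r[of n] X(2) Y(2)
        two_point_statistics_along_characteristics[of \<mu> c1 u0 u c2 v0 v t \<epsilon> X Y, OF u v t X' Y' r(1)[of n]] by simp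
    from is_pdf_unique[OF this f[OF t]]
    show "AE p in lborel. f (t + r n) (X (r n)) (Y (r n)) (fst p) (snd p) = f t x y (fst p) (snd p)"
      by (simp add: split_beta')
  qed
  then show ?thesis
  proof eventually_elim
    case (elim p)
    obtain U V where p: "p = (U, V)" by (cases p)
    \<comment> \<open>The null set comes from the values of \<open>f\<close> alone, so it serves
      every candidate \<open>F'\<close> at once.\<close>
    have "F' (1, c1 x, c2 y) = 0"
      if F': "((\<lambda>(s, a, b). f s a b U V) has_derivative F') (at (t, x, y) within {0..} \<times> UNIV)"
          for F'
    proof (rule directional_derivative_eq_0[where \<gamma> = "\<lambda>s. (t + s, X s, Y s)" and S = "{0..\<epsilon>}" and T = "{0..} \<times> UNIV"
          and F = "\<lambda>(s, a, b). f s a b U V"])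
      show "((\<lambda>(s, a, b). f s a b U V) has_derivative F') 
          (at ((\<lambda>s. (t + s, X s, Y s)) 0) within {0..} \<times> UNIV)"
        using F' X(2) Y(2) by simp
      show "((\<lambda>s. (t + s, X s, Y s)) has_vector_derivative (1, c1 x, c2 y)) (at 0 within {0..\<epsilon>})"
        using has_vector_derivative_at_within X'[of 0] Y'[of 0] X(2) Y(2) \<epsilon>
        by (auto intro!: derivative_eq_intros simp: has_real_derivative_iff_has_vector_derivative)
      show "(\<lambda>s. (t + s, X s, Y s)) ` {0..\<epsilon>} \<subseteq> {0..} \<times> UNIV" using t by auto
    qed (use r_lim r elim p X(2) Y(2) in auto)
    then show ?case by (simp add: p)
  qed
qed

text \<open>The partial derivatives are the values of \<open>g'\<close> on the three unit vectors;
  by linearity their combination with weights 1, \<open>c1 x\<close>, \<open>c2 y\<close> is the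
  derivative in the characteristic direction.\<close>

lemma transport_eq_atI:
  assumes t: "0 \<le> t"
    and g: "((\<lambda>(s, a, b). g s a b) has_derivative g') (at (t, x, y) within {0..} \<times> UNIV)"
    and eq: "g' (1, c1 x, c2 y) = 0"
  shows "transport_eq_at c1 c2 g t x y"
  unfolding transport_eq_at_def
proof (intro exI conjI)
  have "((\<lambda>s. (s, x, y)) has_vector_derivative (1, 0, 0)) (at t within {0..})"
    by (auto intro!: derivative_eq_intros simp: zero_prod_def)
  from has_real_derivative_along_curve[OF _ this, OF g]
  show "((\<lambda>s. g s x y) has_real_derivative g' (1, 0, 0)) (at t within {0..})" by auto
  have "((\<lambda>a. (t, a, y)) has_vector_derivative (0, 1, 0)) (at x)"
    by (auto intro!: derivative_eq_intros simp: zero_prod_def)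
  from has_real_derivative_along_curve[OF _ this, OF g]
  show "((\<lambda>a. g t a y) has_real_derivative g' (0, 1, 0)) (at x)" using t by auto
  have "((\<lambda>b. (t, x, b)) has_vector_derivative (0, 0, 1)) (at y)"
    by (auto intro!: derivative_eq_intros simp: zero_prod_def)
  from has_real_derivative_along_curve[OF _ this, OF g]
  show "((\<lambda>b. g t x b) has_real_derivative g' (0, 0, 1)) (at y)" using t by auto
  interpret linear g' by (rule has_derivative_linear[OF g])
  have "g' (1, c1 x, c2 y) = g' ((1, 0, 0) + c1 x *\<^sub>R (0, 1, 0) + c2 y *\<^sub>R (0, 0, 1))" by simp
  also have "\<dots> = g' (1, 0, 0) + c1 x * g' (0, 1, 0) + c2 y * g' (0, 0, 1)"
    by (simp only: add scaleR real_scaleR_def)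
  finally show "g' (1, 0, 0) + c1 x * g' (0, 1, 0) + c2 y * g' (0, 0, 1) = 0" using eq by simp
qed

text \<open>Dyadic rounding gives rational points that converge to (t, x, y) and stay in the
  half-space on which \<open>\<phi>\<close> is assumed continuous.\<close>

lemma continuous_eq_0_if_rational_eq_0:
  fixes \<phi> :: "real \<times> real \<times> real \<Rightarrow> real"
  assumes cont: "continuous_on ({0..} \<times> UNIV) \<phi>"
    and rat: "\<And>p. p \<in> (\<rat> \<inter> {0..}) \<times> \<rat> \<times> \<rat> \<Longrightarrow> \<phi> p = 0"
    and t: "0 \<le> t"
  shows "\<phi> (t, x, y) = 0"
proof -
  define r where "r n s = real_of_int \<lfloor>s * 2 ^ n\<rfloor> / 2 ^ n" for n and s :: real
  have r: "(\<lambda>n. r n s) \<longlonglongrightarrow> s" "r n s \<in> \<rat>" "0 \<le> r n t" for n s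
    using dyadic_floor_tendsto[of s] t by (simp_all add: r_def)
  have "(\<lambda>n. \<phi> (r n t, r n x, r n y)) \<longlonglongrightarrow> \<phi> (t, x, y)"
    using r t by (intro continuous_on_tendsto_compose[OF cont] tendsto_Pair) auto
  moreover have "\<phi> (r n t, r n x, r n y) = 0" for n by (rule rat) (use r in auto)
  ultimately show ?thesis by (simp add: LIMSEQ_const_iff)
qed

text \<open>The exceptional null set in \<open>dir\<close> depends on (t, x, y), and an uncountable
  union of null sets need not be null. So \<open>dir\<close> is used on the countable set
  \<open>Q\<close> only; continuity of the directional derivative in (t, x, y) covers the other
  points.\<close>

lemma AE_pdf_transport_C1:
  assumes c: "continuous_on UNIV c1" "continuous_on UNIV c2"
    and dir: "\<And>t x y. 0 \<le> t \<Longrightarrow> AE (U, V) in lborel. \<forall>F'.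
      ((\<lambda>(s, a, b). f s a b U V) has_derivative F') (at (t, x, y) within {0..} \<times> UNIV) \<longrightarrow>
      F' (1, c1 x, c2 y) = 0"
  shows "AE (U, V) in lborel. C1_on ({0..} \<times> UNIV) (\<lambda>(s, a, b). f s a b U V) \<longrightarrow>
    (\<forall>t\<ge>0. \<forall>x y. transport_eq_at c1 c2 (\<lambda>s a b. f s a b U V) t x y)"
proof -
  define Q :: "(real \<times> real \<times> real) set" where "Q = (\<rat> \<inter> {0..}) \<times> \<rat> \<times> \<rat>"
  have "countable Q" unfolding Q_def by (intro countable_SIGMA countable_Int1 countable_rat)
  have "AE p in lborel. \<forall>q\<in>Q. \<forall>F'.
      ((\<lambda>(s, a, b). f s a b (fst p) (snd p)) has_derivative F') (at q within {0..} \<times> UNIV) \<longrightarrow>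
      F' (1, c1 (fst (snd q)), c2 (snd (snd q))) = 0"
    using \<open>countable Q\<close> dir by (subst AE_ball_countable) (auto simp: Q_def split_beta')
  then show ?thesis
  proof eventually_elim
    case (elim p)
    obtain U V where p: "p = (U, V)" by (cases p)
    have "transport_eq_at c1 c2 (\<lambda>s a b. f s a b U V) t x y"
      if C1: "C1_on ({0..} \<times> UNIV) (\<lambda>(s, a, b). f s a b U V)" and t: "0 \<le> t" for t x y
    proof -
      obtain F' where F': "continuous_on ({0..} \<times> UNIV) F'"
        "\<And>q. q \<in> {0..} \<times> UNIV \<Longrightarrow>
          ((\<lambda>(s, a, b). f s a b U V) has_derivative blinfun_apply (F' q))
              (at q within {0..} \<times> UNIV)"
        using C1 unfolding C1_on_def by blast
      have "(\<lambda>q. F' q (1, c1 (fst (snd q)), c2 (snd (snd q)))) (t, x, y) = 0"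
      proof (rule continuous_eq_0_if_rational_eq_0[OF _ _ t])
        show "continuous_on ({0..} \<times> UNIV) (\<lambda>q. F' q (1, c1 (fst (snd q)), c2 (snd (snd q))))"
          by (intro continuous_intros F' continuous_on_compose2[OF c(1)] continuous_on_compose2[OF c(2)]) auto
        show "F' q (1, c1 (fst (snd q)), c2 (snd (snd q))) = 0" if "q \<in> (\<rat> \<inter> {0..}) \<times> \<rat> \<times> \<rat>" for q
          using elim F'(2)[of q] that by (auto simp: p Q_def)
      qed
      then show ?thesis
          using t F'(2)[of "(t, x, y)"] by (intro transport_eq_atI[where g' = "blinfun_apply (F' (t, x, y))"]) auto
    qed
    then show ?case unfolding p by auto
  qed
qed

subsection \<open>Integration by parts\<close>

lemma set_integrable_continuous_bounded_support:
  fixes g :: "'a::euclidean_space \<Rightarrow> real"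
  assumes "closed T" "continuous_on T g" "\<And>p. p \<in> T \<Longrightarrow> R < norm p \<Longrightarrow> g p = 0"
  shows "set_integrable lborel T g"
proof -
  have "compact (T \<inter> cball 0 R)"
    using assms(1) by (rule closed_Int_compact) simp
  then have "integrable lborel (\<lambda>p. indicator (T \<inter> cball 0 R) p *\<^sub>R g p)"
    using assms(2) by (intro borel_integrable_compact) (auto intro: continuous_on_subset)
  moreover have "(\<lambda>p. indicator (T \<inter> cball 0 R) p *\<^sub>R g p) = (\<lambda>p. indicator T p *\<^sub>R g p)"
    using assms(3) by (auto simp: indicator_def not_le fun_eq_iff)
  ultimately show ?thesis by (simp only: set_integrable_def)
qed

text \<open>The end values of \<open>G\<close> stay in the result: at t = 0 they give the initial
  datum, at all other ends they vanish in the uses below. Taking \<open>T\<close> as the half-line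
  or the whole line covers time and space.\<close>

lemma integral_derivative_bounded_support:
  fixes G g :: "real \<Rightarrow> real"
  assumes "a \<le> b" "{a..b} \<subseteq> T"
    and G: "\<And>s. s \<in> T \<Longrightarrow> (G has_real_derivative g s) (at s within T)"
    and "continuous_on T g" "\<And>s. s \<in> T \<Longrightarrow> s \<notin> {a..b} \<Longrightarrow> g s = 0"
  shows "(LINT s:T|lborel. g s) = G b - G a"
proof -
  have "(LINT s:T|lborel. g s) = (\<integral>s. indicator {a..b} s *\<^sub>R g s \<partial>lborel)"
    unfolding set_lebesgue_integral_def using assms(2,5)
    by (intro Bochner_Integration.integral_cong) (auto simp: indicator_def)
  also have "\<dots> = G b - G a"
  proof (rule integral_FTC_atLeastAtMost)
    show "(G has_vector_derivative g s) (at s within {a..b})" if "a \<le> s" "s \<le> b" for s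
      using DERIV_subset[OF G assms(2)] assms(2) that
      by (auto simp: has_real_derivative_iff_has_vector_derivative)
  qed (use assms in \<open>auto intro: continuous_on_subset\<close>)
  finally show ?thesis .
qed

text \<open>Fubini with the time integral inside. The upper end lies outside the support, so only
  the lower end t = 0 contributes, with a minus sign.\<close>

lemma integral_time_derivative:
  fixes H h :: "real \<times> 'a::euclidean_space \<Rightarrow> real"
  assumes H: "\<And>t z. 0 \<le> t \<Longrightarrow> ((\<lambda>s. H (s, z)) has_real_derivative h (t, z)) (at t within {0..})"
    and cont: "continuous_on ({0..} \<times> UNIV) h"
    and supp: "\<And>p. p \<in> {0..} \<times> UNIV \<Longrightarrow> R < norm p \<Longrightarrow> H p = 0 \<and> h p = 0" and "0 \<le> R"
  shows "(LINT p:{0..} \<times> UNIV|lborel. h p) = - (LINT z|lborel. H (0, z))"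
proof -
  have int: "integrable (lborel \<Otimes>\<^sub>M lborel) (\<lambda>(t, z). indicator ({0..} \<times> UNIV) (t, z) *\<^sub>R h (t, z))"
    using set_integrable_continuous_bounded_support[OF _ cont, of R] supp
    by (simp add: closed_Times lborel_prod set_integrable_def case_prod_eta[of "\<lambda>p. indicat_real _ p * _ p"])
  have "(LINT p:{0..} \<times> UNIV|lborel. h p) = 
    (\<integral>z. (\<integral>t. indicator ({0..} \<times> UNIV) (t, z) *\<^sub>R h (t, z) \<partial>lborel) \<partial>lborel)"
    using lborel_pair.integral_snd[OF int] by
        (simp add: set_lebesgue_integral_def lborel_prod split_beta')
  also have "\<dots> = (\<integral>z. - H (0, z) \<partial>lborel)"
  proof (rule Bochner_Integration.integral_cong[OF refl])
    fix z :: 'a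
    \<comment> \<open>The support bound is strict, so the end point is R + 1 rather than R, where
      \<open>H\<close> might not vanish.\<close>
    have R: "R < norm (R + 1, z)" using norm_fst_le[of "R + 1" z] \<open>0 \<le> R\<close> by simp
    have "(LINT t:{0..}|lborel. h (t, z)) = H (R + 1, z) - H (0, z)"
    proof (rule integral_derivative_bounded_support[where G = "\<lambda>s. H (s, z)" and a = 0
        and b = "R + 1"])
      show "continuous_on {0..} (\<lambda>t. h (t, z))"
        by (rule continuous_on_compose2[OF cont]) (auto intro!: continuous_intros)
      show "h (s, z) = 0" if "s \<in> {0..}" "s \<notin> {0..R + 1}" for s
        using supp[of "(s, z)"] norm_fst_le[of s z] that by auto
    qed (use H \<open>0 \<le> R\<close> in auto)
    then show "(\<integral>t. indicator ({0..} \<times> UNIV) (t, z) *\<^sub>R h (t, z) \<partial>lborel) = - H (0, z)"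
      using supp[of "(R + 1, z)"] R \<open>0 \<le> R\<close>
      by (simp add: set_lebesgue_integral_def indicator_times)
  qed
  finally show ?thesis by simp
qed

lemma integral_partial_derivative_fst:
  fixes H h :: "real \<times> 'a::euclidean_space \<Rightarrow> real"
  assumes H: "\<And>a z. ((\<lambda>s. H (s, z)) has_real_derivative h (a, z)) (at a)"
    and cont: "continuous_on UNIV h"
    and supp: "\<And>p. R < norm p \<Longrightarrow> H p = 0 \<and> h p = 0" and "0 \<le> R"
  shows "(LINT p|lborel. h p) = 0"
proof -
  have int: "integrable (lborel \<Otimes>\<^sub>M lborel) (\<lambda>(a, z). h (a, z))"
    using set_integrable_continuous_bounded_support[OF _ cont, of R] supp
    by (simp add: lborel_prod set_integrable_def)
  have "(LINT p|lborel. h p) = (\<integral>z. (\<integral>a. h (a, z) \<partial>lborel) \<partial>lborel)"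
    using lborel_pair.integral_snd[OF int] by (simp add: lborel_prod)
  also have "\<dots> = (\<integral>z. 0 \<partial>(lborel :: 'a measure))"
  proof (rule Bochner_Integration.integral_cong[OF refl])
    fix z :: 'a
    have R: "R < norm (R + 1, z)" "R < norm (- R - 1, z)"
      using norm_fst_le[of "R + 1" z] norm_fst_le[of "- R - 1" z] \<open>0 \<le> R\<close> by simp_all
    have "(LINT a:UNIV|lborel. h (a, z)) = H (R + 1, z) - H (- R - 1, z)"
    proof (rule integral_derivative_bounded_support[where G = "\<lambda>s. H (s, z)" and a = "- R - 1"
        and b = "R + 1"])
      show "continuous_on UNIV (\<lambda>a. h (a, z))"
        by (rule continuous_on_compose2[OF cont]) (auto intro!: continuous_intros)
      show "h (s, z) = 0" if "s \<notin> {- R - 1..R + 1}" for s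
        using supp[of "(s, z)"] norm_fst_le[of s z] that by auto
    qed (use H \<open>0 \<le> R\<close> in auto)
    then show "(\<integral>a. h (a, z) \<partial>lborel) = 0"
      using supp[OF R(1)] supp[OF R(2)] by (simp add: set_lebesgue_integral_def)
  qed
  finally show ?thesis by simp
qed

text \<open>Exchanging the two coordinates preserves both Lebesgue measure and the norm, which
  reduces the claim to the first coordinate.\<close>

lemma integral_partial_derivative_snd:
  fixes H h :: "'a::euclidean_space \<times> real \<Rightarrow> real"
  assumes H: "\<And>z b. ((\<lambda>s. H (z, s)) has_real_derivative h (z, b)) (at b)"
    and cont: "continuous_on UNIV h"
    and supp: "\<And>p. R < norm p \<Longrightarrow> H p = 0 \<and> h p = 0" and "0 \<le> R"
  shows "(LINT p|lborel. h p) = 0"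
proof -
  have "(LINT p|lborel. h p) = (LINT p|(lborel \<Otimes>\<^sub>M lborel). h p)" by (simp add: lborel_prod)
  also have "\<dots> = (LINT (b, z)|(lborel \<Otimes>\<^sub>M lborel). h (z, b))"
    using borel_measurable_continuous_onI[OF cont]
    by (subst lborel_pair.integral_product_swap) (simp_all add: lborel_prod)
  also have "\<dots> = (LINT p|lborel. (\<lambda>(b, z). h (z, b)) p)" by (simp add: lborel_prod)
  also have "\<dots> = 0"
  proof (rule integral_partial_derivative_fst[where R = R and H = "\<lambda>(b, z). H (z, b)"])
    show "continuous_on UNIV (\<lambda>(b, z). h (z, b))"
      unfolding split_beta' by (rule continuous_on_compose2[OF cont])
          (auto intro!: continuous_intros)
    show "R < norm p \<Longrightarrow> (case p of (b, z) \<Rightarrow> H (z, b)) = 0 \<and> (case p of (b, z) \<Rightarrow> h (z, b)) = 0" for p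
      using supp[of "(snd p, fst p)"] by (simp add: norm_Pair split_beta norm_prod_def add.commute)
  qed (use H \<open>0 \<le> R\<close> in auto)
  finally show ?thesis .
qed

text \<open>For the space derivatives, whose integrals over the plane vanish at each fixed time;
  Fubini with the space integral inside carries this over to the half-space.\<close>

lemma set_integral_slices_eq_0:
  fixes h :: "real \<times> 'a::euclidean_space \<Rightarrow> real"
  assumes cont: "continuous_on ({0..} \<times> UNIV) h"
    and supp: "\<And>p. p \<in> {0..} \<times> UNIV \<Longrightarrow> R < norm p \<Longrightarrow> h p = 0"
    and slice: "\<And>t. 0 \<le> t \<Longrightarrow> (LINT z|lborel. h (t, z)) = 0"
  shows "(LINT p:{0..} \<times> UNIV|lborel. h p) = 0"
proof -
  have int: "integrable (lborel \<Otimes>\<^sub>M lborel) (\<lambda>(t, z). indicator ({0..} \<times> UNIV) (t, z) *\<^sub>R h (t, z))"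
    using set_integrable_continuous_bounded_support[OF _ cont, of R] supp
    by (simp add: closed_Times lborel_prod set_integrable_def case_prod_eta[of "\<lambda>p. indicat_real _ p * _ p"])
  have "(LINT p:{0..} \<times> UNIV|lborel. h p) = 
    (\<integral>t. (\<integral>z. indicator ({0..} \<times> UNIV) (t, z) *\<^sub>R h (t, z) \<partial>lborel) \<partial>lborel)"
    using lborel_pair.integral_fst[OF int] by
        (simp add: set_lebesgue_integral_def lborel_prod split_beta')
  also have "\<dots> = (\<integral>t. 0 \<partial>(lborel :: real measure))"
    using slice by (intro Bochner_Integration.integral_cong) (auto simp: indicator_def)
  finally show ?thesis by simp
qed

section \<open>Test functions and the adjoint expression\<close>

lemma test_function_derivative:
  assumes "test_function \<psi>"
  obtains \<psi>' R where "continuous_on UNIV \<psi>'" "\<And>p. (\<psi> has_derivative blinfun_apply (\<psi>' p)) (at p)"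
    "0 \<le> R" "\<And>p. R < norm p \<Longrightarrow> \<psi> p = 0" "\<And>p. R < norm p \<Longrightarrow> \<psi>' p = 0"
proof -
  obtain \<psi>' where \<psi>': "continuous_on UNIV \<psi>'" "\<And>p. (\<psi> has_derivative blinfun_apply (\<psi>' p)) (at p)"
    using assms unfolding test_function_def C1_on_def by auto
  have "bounded (closure {p. \<psi> p \<noteq> 0})"
    using assms compact_imp_bounded by (auto simp: test_function_def)
  then obtain R where R: "0 < R" "\<And>p. p \<in> closure {p. \<psi> p \<noteq> 0} \<Longrightarrow> norm p \<le> R"
    unfolding bounded_pos by blast
  have 0: "\<psi> p = 0" if "R < norm p" for p
    using R(2)[of p] closure_subset[of "{p. \<psi> p \<noteq> 0}"] that by fastforce
  have "\<psi>' p = 0" if p: "R < norm p" for p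
  proof -
    \<comment> \<open>Off the closed ball \<open>\<psi>\<close> is 0 on an open set, so its
      derivative is 0 there too.\<close>
    have "open (- cball 0 R)" by (simp add: open_Compl)
    then have "((\<lambda>_. 0) has_derivative blinfun_apply (\<psi>' p)) (at p)"
      using 0 p by (intro has_derivative_transform_within_open[OF \<psi>'(2)]) auto
    from has_derivative_unique[OF this has_derivative_const]
    show ?thesis by (intro blinfun_eqI) simp
  qed
  then show ?thesis using that \<psi>' R(1) 0 by (metis less_imp_le)
qed

text \<open>\<open>adjoint_transport\<close> is written with \<open>deriv\<close>, which has a value
  even where no derivative exists. Here all derivatives exist, and the product rule produces the
  terms with \<open>c1'\<close> and \<open>c2'\<close>.\<close>

lemma adjoint_transport_eq:
  assumes \<psi>': "\<And>p. (\<psi> has_derivative \<psi>' p) (at p)"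
    and c: "\<And>x. (c1 has_real_derivative c1' x) (at x)" "\<And>x. (c2 has_real_derivative c2' x) (at x)"
  shows "adjoint_transport c1 c2 \<psi> t x y U V = \<psi>' (t, x, y, U, V) (1, 0, 0, 0, 0) +
    (c1' x * \<psi> (t, x, y, U, V) + c1 x * \<psi>' (t, x, y, U, V) (0, 1, 0, 0, 0)) +
    (c2' y * \<psi> (t, x, y, U, V) + c2 y * \<psi>' (t, x, y, U, V) (0, 0, 1, 0, 0))"
proof -
  have "((\<lambda>s. (s, x, y, U, V)) has_vector_derivative (1, 0, 0, 0, 0)) (at t)"
    by (auto intro!: derivative_eq_intros simp: zero_prod_def)
  from has_real_derivative_along_curve[OF _ this, OF \<psi>']
  have 1: "((\<lambda>s. \<psi> (s, x, y, U, V)) has_real_derivative \<psi>' (t, x, y, U, V) (1, 0, 0, 0, 0))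
      (at t)" by simp
  have "((\<lambda>a. (t, a, y, U, V)) has_vector_derivative (0, 1, 0, 0, 0)) (at x)"
    by (auto intro!: derivative_eq_intros simp: zero_prod_def)
  from has_real_derivative_along_curve[OF _ this, OF \<psi>']
  have "((\<lambda>a. \<psi> (t, a, y, U, V)) has_real_derivative \<psi>' (t, x, y, U, V) (0, 1, 0, 0, 0))
      (at x)" by simp
  from DERIV_mult[OF c(1) this]
  have 2: "((\<lambda>a. c1 a * \<psi> (t, a, y, U, V)) has_real_derivative 
    (c1' x * \<psi> (t, x, y, U, V) + c1 x * \<psi>' (t, x, y, U, V) (0, 1, 0, 0, 0))) (at x)"
    by (simp add: mult.commute)
  have "((\<lambda>b. (t, x, b, U, V)) has_vector_derivative (0, 0, 1, 0, 0)) (at y)"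
    by (auto intro!: derivative_eq_intros simp: zero_prod_def)
  from has_real_derivative_along_curve[OF _ this, OF \<psi>']
  have "((\<lambda>b. \<psi> (t, x, b, U, V)) has_real_derivative \<psi>' (t, x, y, U, V) (0, 0, 1, 0, 0))
      (at y)" by simp
  from DERIV_mult[OF c(2) this]
  have 3: "((\<lambda>b. c2 b * \<psi> (t, x, b, U, V)) has_real_derivative 
    (c2' y * \<psi> (t, x, y, U, V) + c2 y * \<psi>' (t, x, y, U, V) (0, 0, 1, 0, 0))) (at y)"
    by (simp add: mult.commute)
  show ?thesis
    using 1 2 3 by (simp add: adjoint_transport_def DERIV_imp_deriv)
qed

lemma continuous_on_adjoint_transport:
  assumes \<psi>: "continuous_on UNIV \<psi>'" "\<And>p. (\<psi> has_derivative blinfun_apply (\<psi>' p)) (at p)"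
    and c: "\<And>x. (c1 has_real_derivative c1' x) (at x)" "\<And>x. (c2 has_real_derivative c2' x) (at x)"
    and c': "continuous_on UNIV c1'" "continuous_on UNIV c2'"
  shows "continuous_on UNIV (\<lambda>(t, x, y, U, V). adjoint_transport c1 c2 \<psi> t x y U V)"
proof -
  have "continuous_on UNIV c1" "continuous_on UNIV c2" "continuous_on UNIV \<psi>"
    using DERIV_continuous_on[OF c(1)] DERIV_continuous_on[OF c(2)] has_derivative_continuous_on[OF \<psi>(2)]
    by auto
  then show ?thesis
    unfolding adjoint_transport_eq[OF \<psi>(2) c] split_beta' prod.collapse
    using \<psi>(1) c' by (auto intro!: continuous_intros intro: continuous_on_compose2)
qed

text \<open>By the chain rule the divergence of (h, c1 h, c2 h) for h = \<psi>(t, x, y, u, v)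
  differs from the adjoint expression by two terms: the U- and V-derivatives of \<psi> times u_t +
  c1 u_x and v_t + c2 v_y. Both vanish.\<close>

lemma integral_adjoint_transport_along_solutions:
  assumes \<psi>: "test_function \<psi>"
    and c: "\<And>x. (c1 has_real_derivative c1' x) (at x)" "\<And>x. (c2 has_real_derivative c2' x) (at x)"
    and c': "continuous_on UNIV c1'" "continuous_on UNIV c2'"
    and u: "classical_solution1 c1 u0 u" and v: "classical_solution1 c2 v0 v"
  shows "(LINT (t, x, y):{0..} \<times> UNIV|lborel. adjoint_transport c1 c2 \<psi> t x y (u t x) (v t y)) =
    - (LINT (x, y)|lborel. \<psi> (0, x, y, u0 x, v0 y))"
proof -
  obtain \<psi>' R where \<psi>': "continuous_on UNIV \<psi>'" "\<And>p. (\<psi> has_derivative blinfun_apply (\<psi>' p)) (at p)"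
    and R: "0 \<le> R" "\<And>p. R < norm p \<Longrightarrow> \<psi> p = 0" "\<And>p. R < norm p \<Longrightarrow> \<psi>' p = 0"
    using test_function_derivative[OF \<psi>] by metis
  have cont_\<psi>: "continuous_on UNIV \<psi>"
    using has_derivative_continuous_on[OF \<psi>'(2)] by auto
  have cont_c: "continuous_on UNIV c1" "continuous_on UNIV c2"
    using DERIV_continuous_on[OF c(1)] DERIV_continuous_on[OF c(2)] by auto
  obtain u' where u': "continuous_on ({0..} \<times> UNIV) u'"
    "\<And>t x. 0 \<le> t \<Longrightarrow>
      ((\<lambda>(t, x). u t x) has_derivative blinfun_apply (u' (t, x))) (at (t, x) within {0..} \<times> UNIV)"
    "\<And>t x. 0 \<le> t \<Longrightarrow> u' (t, x) (1, 0) + c1 x * u' (t, x) (0, 1) = 0"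
    using classical_solution1_derivative[OF u] by metis
  obtain v' where v': "continuous_on ({0..} \<times> UNIV) v'"
    "\<And>t x. 0 \<le> t \<Longrightarrow>
      ((\<lambda>(t, x). v t x) has_derivative blinfun_apply (v' (t, x))) (at (t, x) within {0..} \<times> UNIV)"
    "\<And>t x. 0 \<le> t \<Longrightarrow> v' (t, x) (1, 0) + c2 x * v' (t, x) (0, 1) = 0"
    using classical_solution1_derivative[OF v] by metis
  let ?S = "{0..} \<times> UNIV :: (real \<times> real \<times> real) set"
  \<comment> \<open>The graph map of the realization; \<open>\<psi>\<close> composed with it is the
    function h.\<close>
  define q where "q = (\<lambda>(t, x, y). (t, x, y, u t x, v t y))"
  \<comment> \<open>The three terms of the divergence, computed by the chain rule. \<open>u\<close>
    does not depend on y, nor \<open>v\<close> on x, hence the zeros in the last two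
    entries.\<close>
  define ht where "ht
      = (\<lambda>(t, x, y). \<psi>' (q (t, x, y)) (1, 0, 0, u' (t, x) (1, 0), v' (t, y) (1, 0)))"
  define hx where "hx = (\<lambda>(t, x, y). c1' x * \<psi> (q (t, x, y)) +
    c1 x * \<psi>' (q (t, x, y)) (0, 1, 0, u' (t, x) (0, 1), 0))"
  define hy where "hy = (\<lambda>(t, x, y). c2' y * \<psi> (q (t, x, y)) +
    c2 y * \<psi>' (q (t, x, y)) (0, 0, 1, 0, v' (t, y) (0, 1)))"
  have cont_w: "continuous_on ?S (\<lambda>p. u (fst p) (fst (snd p)))"
    "continuous_on ?S (\<lambda>p. v (fst p) (snd (snd p)))"
  proof -
    have cont: "continuous_on ({0..} \<times> UNIV) (\<lambda>(t, x). u t x)"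
        "continuous_on ({0..} \<times> UNIV) (\<lambda>(t, x). v t x)"
      using u v by (simp_all add: classical_solution1_def C1_on_imp_continuous_on)
    have "continuous_on ?S (\<lambda>p. (\<lambda>(t, x). u t x) (fst p, fst (snd p)))"
      by (rule continuous_on_compose2[OF cont(1)]) (auto intro!: continuous_intros)
    moreover have "continuous_on ?S (\<lambda>p. (\<lambda>(t, x). v t x) (fst p, snd (snd p)))"
      by (rule continuous_on_compose2[OF cont(2)]) (auto intro!: continuous_intros)
    ultimately show "continuous_on ?S (\<lambda>p. u (fst p) (fst (snd p)))"
      "continuous_on ?S (\<lambda>p. v (fst p) (snd (snd p)))"
      by simp_all
  qed
  have cont_w': "continuous_on ?S (\<lambda>p. u' (fst p, fst (snd p)))"
    "continuous_on ?S (\<lambda>p. v' (fst p, snd (snd p)))"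
    by (rule continuous_on_compose2[OF u'(1)] continuous_on_compose2[OF v'(1)];
        auto intro!: continuous_intros)+
  have cont_q: "continuous_on ?S q"
    unfolding q_def split_beta' by (intro continuous_intros cont_w)
  note comp = continuous_on_compose2[OF \<psi>'(1) cont_q subset_UNIV] continuous_on_compose2[OF cont_\<psi> cont_q subset_UNIV]
  have cont_h: "continuous_on ?S ht" "continuous_on ?S hx" "continuous_on ?S hy"
    unfolding ht_def hx_def hy_def split_beta' prod.collapse
    by (intro continuous_intros comp cont_w'
        continuous_on_compose2[OF cont_c(1)] continuous_on_compose2[OF c'(1)]
        continuous_on_compose2[OF cont_c(2)] continuous_on_compose2[OF c'(2)] subset_UNIV)+
  \<comment> \<open>The graph map does not decrease norms, so the bounded support passes from
    \<open>\<psi>\<close> to the composite functions.\<close>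
  have norm_q: "norm p \<le> norm (q p)" for p
    by (auto simp: q_def norm_Pair split: prod.split)
  have supp: "\<psi> (q p) = 0" "\<psi>' (q p) = 0" if "R < norm p" for p
    using R(2,3) norm_q[of p] that by (auto intro: less_le_trans)
  have supp_h: "ht p = 0" "hx p = 0" "hy p = 0" if "R < norm p" for p
    using supp[OF that] by (auto simp: ht_def hx_def hy_def split: prod.split)
  have dt: "((\<lambda>s. \<psi> (q (s, z))) has_real_derivative ht (t, z)) (at t within {0..})"
    if t: "0 \<le> t" for t z
  proof -
    obtain x y where z: "z = (x, y)" by (cases z)
    have "((\<lambda>s. (s, x)) has_vector_derivative (1, 0)) (at t within {0..})"
         "((\<lambda>s. (s, y)) has_vector_derivative (1, 0)) (at t within {0..})"
      by (auto intro!: derivative_eq_intros)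
    from has_real_derivative_along_curve[OF _ this(1), OF u'(2)[OF t]]
      has_real_derivative_along_curve[OF _ this(2), OF v'(2)[OF t]]
    have "((\<lambda>s. q (s, z)) has_vector_derivative (1, 0, 0, u' (t, x) (1, 0), v' (t, y) (1, 0)))
        (at t within {0..})"
      unfolding q_def z
      by (auto intro!: derivative_eq_intros simp: has_real_derivative_iff_has_vector_derivative zero_prod_def image_subset_iff)
    from has_real_derivative_along_curve[OF \<psi>'(2) this subset_UNIV]
    show ?thesis by (simp add: ht_def z)
  qed
  have dx: "((\<lambda>a. c1 a * \<psi> (q (t, a, y))) has_real_derivative hx (t, x, y)) (at x)"
    if t: "0 \<le> t" for t x y
  proof -
    have "((\<lambda>a. (t, a)) has_vector_derivative (0, 1)) (at x)"
      by (auto intro!: derivative_eq_intros)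
    from has_real_derivative_along_curve[OF _ this, OF u'(2)[OF t]] t
    have "((\<lambda>a. q (t, a, y)) has_vector_derivative (0, 1, 0, u' (t, x) (0, 1), 0)) (at x)"
      unfolding q_def
      by (auto intro!: derivative_eq_intros simp: has_real_derivative_iff_has_vector_derivative zero_prod_def image_subset_iff)
    from DERIV_mult[OF c(1) has_real_derivative_along_curve[OF \<psi>'(2) this subset_UNIV]]
    show ?thesis by (simp add: hx_def mult.commute)
  qed
  have dy: "((\<lambda>b. c2 b * \<psi> (q (t, x, b))) has_real_derivative hy (t, x, y)) (at y)"
    if t: "0 \<le> t" for t x y
  proof -
    have "((\<lambda>b. (t, b)) has_vector_derivative (0, 1)) (at y)"
      by (auto intro!: derivative_eq_intros)
    from has_real_derivative_along_curve[OF _ this, OF v'(2)[OF t]] t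
    have "((\<lambda>b. q (t, x, b)) has_vector_derivative (0, 0, 1, 0, v' (t, y) (0, 1))) (at y)"
      unfolding q_def
      by (auto intro!: derivative_eq_intros simp: has_real_derivative_iff_has_vector_derivative zero_prod_def image_subset_iff)
    from DERIV_mult[OF c(2) has_real_derivative_along_curve[OF \<psi>'(2) this subset_UNIV]]
    show ?thesis by (simp add: hy_def mult.commute)
  qed
  have adjoint: "adjoint_transport c1 c2 \<psi> t x y (u t x) (v t y) = ht (t, x, y) + hx (t, x, y) + hy (t, x, y)"
    if t: "0 \<le> t" for t x y
  proof -
    let ?L = "blinfun_apply (\<psi>' (q (t, x, y)))"
    \<comment> \<open>Linearity separates the U- and V-directions, whose coefficients are governed
      by the equations for \<open>u\<close> and \<open>v\<close>.\<close>
    have L: "?L (1, 0, 0, a, b) = ?L (1, 0, 0, 0, 0) + a *\<^sub>R ?L (0, 0, 0, 1, 0) + b *\<^sub>R ?L (0, 0, 0, 0, 1)"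
      "?L (0, 1, 0, a, 0) = ?L (0, 1, 0, 0, 0) + a *\<^sub>R ?L (0, 0, 0, 1, 0)"
      "?L (0, 0, 1, 0, b) = ?L (0, 0, 1, 0, 0) + b *\<^sub>R ?L (0, 0, 0, 0, 1)" for a b
      unfolding blinfun.add_right[symmetric] blinfun.scaleR_right[symmetric] by simp_all
    have "u' (t, x) (1, 0) = - (c1 x * u' (t, x) (0, 1))"
        "v' (t, y) (1, 0) = - (c2 y * v' (t, y) (0, 1))"
      using u'(3)[OF t, of x] v'(3)[OF t, of y] by linarith+
    moreover have "(t, x, y, u t x, v t y) = q (t, x, y)" by (simp add: q_def)
    ultimately show ?thesis
      unfolding adjoint_transport_eq[OF \<psi>'(2) c] ht_def hx_def hy_def case_prod_conv
        L(1)[of "u' (t, x) (1, 0)"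
            "v' (t, y) (1, 0)"] L(2)[of "u' (t, x) (0, 1)"] L(3)[of "v' (t, y) (0, 1)"]
      by (simp add: algebra_simps)
  qed
  have S: "?S \<in> sets borel" by (intro borel_closed closed_Times) auto
  have int: "set_integrable lborel ?S ht" "set_integrable lborel ?S hx"
      "set_integrable lborel ?S hy"
    by (rule set_integrable_continuous_bounded_support[where R = R];
        use cont_h supp_h in \<open>auto simp: closed_Times\<close>)+
  have slice: "continuous_on UNIV (\<lambda>z. h (t, z))" if "continuous_on ?S h" "0 \<le> t"
      for h :: "_ \<Rightarrow> real" and t
    by (rule continuous_on_compose2[OF that(1)]) (use that(2) in \<open>auto intro!: continuous_intros\<close>)
  have supp_slice: "R < norm (t, z)" if "R < norm z" for t :: real and z :: "real \<times> real"
    using norm_snd_le[of z t] that by linarith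
  have "(LINT (t, x, y):?S|lborel. adjoint_transport c1 c2 \<psi> t x y (u t x) (v t y)) =
      (LINT p:?S|lborel. ht p + hx p + hy p)"
    using S by (intro set_lebesgue_integral_cong) (auto simp: adjoint)
  also have "\<dots> = (LINT p:?S|lborel. ht p) + (LINT p:?S|lborel. hx p) + (LINT p:?S|lborel. hy p)"
    using int by (simp add: set_integral_add)
  also have "(LINT p:?S|lborel. ht p) = - (LINT z|lborel. \<psi> (q (0, z)))"
    using dt cont_h(1) supp supp_h(1) R(1)
    by (intro integral_time_derivative[where R = R and H = "\<lambda>p. \<psi> (q p)"]) auto
  also have "(LINT p:?S|lborel. hx p) = 0"
  proof (rule set_integral_slices_eq_0[OF cont_h(2) supp_h(2)])
    show "(LINT z|lborel. hx (t, z)) = 0" if "0 \<le> t" for t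
      using dx[OF that] slice[OF cont_h(2) that] supp(1) supp_h(2) supp_slice R(1)
      by (intro integral_partial_derivative_fst[where R = R and H = "\<lambda>(x, y). c1 x * \<psi> (q (t, x, y))"]) auto
  qed
  also have "(LINT p:?S|lborel. hy p) = 0"
  proof (rule set_integral_slices_eq_0[OF cont_h(3) supp_h(3)])
    show "(LINT z|lborel. hy (t, z)) = 0" if "0 \<le> t" for t
      using dy[OF that] slice[OF cont_h(3) that] supp(1) supp_h(3) supp_slice R(1)
      by (intro integral_partial_derivative_snd[where R = R and H = "\<lambda>(x, y). c2 y * \<psi> (q (t, x, y))"]) auto
  qed
  also have "(LINT z|lborel. \<psi> (q (0, z))) = (LINT (x, y)|lborel. \<psi> (0, x, y, u0 x, v0 y))"
    using u v by (intro Bochner_Integration.integral_cong)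
      (auto simp: q_def classical_solution1_def)
  finally show ?thesis by simp
qed

subsection \<open>Expectations\<close>

text \<open>Freezing \<open>(t, x)\<close> on a dyadic grid leaves only countably many sections to consider.\<close>

lemma borel_measurable_Caratheodory:
  fixes w :: "real \<Rightarrow> real \<Rightarrow> 'w \<Rightarrow> real"
  assumes meas: "\<And>t x. 0 \<le> t \<Longrightarrow> w t x \<in> borel_measurable M"
    and cont: "\<And>\<omega>. \<omega> \<in> space M \<Longrightarrow> continuous_on ({0..} \<times> UNIV) (\<lambda>(t, x). w t x \<omega>)"
  shows "(\<lambda>(\<omega>, t, x). w (max 0 t) x \<omega>) \<in> borel_measurable (M \<Otimes>\<^sub>M borel)"
proof (rule borel_measurable_LIMSEQ_real)
  define r where "r n s = real_of_int \<lfloor>s * 2 ^ n\<rfloor> / 2 ^ n" for n and s :: real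
  have r: "(\<lambda>n. r n s) \<longlonglongrightarrow> s" for s
    unfolding r_def by (rule dyadic_floor_tendsto)
  have r0: "0 \<le> r n (max 0 s)" for n s by (simp add: r_def)
  show "(\<lambda>(\<omega>, t, x). w (r n (max 0 t)) (r n x) \<omega>) \<in> borel_measurable (M \<Otimes>\<^sub>M borel)" for n
  proof -
    let ?N = "M \<Otimes>\<^sub>M (borel :: (real \<times> real) measure)"
    have [measurable]: "(\<lambda>p. \<lfloor>max 0 (fst (snd p)) * 2 ^ n\<rfloor>) \<in> ?N \<rightarrow>\<^sub>M count_space UNIV"
      "(\<lambda>p. \<lfloor>snd (snd p) * 2 ^ n\<rfloor>) \<in> ?N \<rightarrow>\<^sub>M count_space UNIV"
      unfolding borel_prod[symmetric] by measurable
    \<comment> \<open>The maximum with 0 makes the time admissible for every integer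
      \<open>i\<close>; for the indices that occur it changes nothing.\<close>
    have "(\<lambda>p. w (max 0 (of_int i / 2 ^ n)) (of_int j / 2 ^ n) (fst p)) \<in> borel_measurable ?N"
        for i j :: int
      by (rule measurable_compose[OF measurable_fst meas]) simp
    then have "(\<lambda>p. w (max 0 (of_int \<lfloor>max 0 (fst (snd p)) * 2 ^ n\<rfloor> / 2 ^ n)) (of_int j / 2 ^ n) (fst p))
        \<in> borel_measurable ?N" for j :: int
      by (rule measurable_compose_countable) measurable
    then have "(\<lambda>p. w (max 0 (of_int \<lfloor>max 0 (fst (snd p)) * 2 ^ n\<rfloor> / 2 ^ n))
        (of_int \<lfloor>snd (snd p) * 2 ^ n\<rfloor> / 2 ^ n) (fst p)) \<in> borel_measurable ?N"
      by (rule measurable_compose_countable) measurable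
    moreover have "max 0 (of_int \<lfloor>max 0 s * 2 ^ n\<rfloor> / 2 ^ n) = r n (max 0 s)" for s
      using r0[of n s] by (simp add: r_def)
    ultimately show ?thesis by (simp add: r_def split_beta')
  qed
  fix p assume "p \<in> space (M \<Otimes>\<^sub>M (borel :: (real \<times> real) measure))"
  then obtain \<omega> t x where p: "p = (\<omega>, t, x)" and \<omega>: "\<omega> \<in> space M" by (auto simp: space_pair_measure)
  have "(\<lambda>n. (\<lambda>(t, x). w t x \<omega>) (r n (max 0 t), r n x)) \<longlonglongrightarrow> (\<lambda>(t, x). w t x \<omega>) (max 0 t, x)"
    using r r0 by (intro continuous_on_tendsto_compose[OF cont[OF \<omega>]] tendsto_Pair) auto
  then show "(\<lambda>n. case p of (\<omega>, t, x) \<Rightarrow> w (r n (max 0 t)) (r n x) \<omega>)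
      \<longlonglongrightarrow> (case p of (\<omega>, t, x) \<Rightarrow> w (max 0 t) x \<omega>)"
    by (simp add: p)
qed

text \<open>Both sides of the second claim integrate \<open>\<phi>\<close> against the law of
  \<open>Z\<close>, once through its density and once as an image measure. Boundedness of
  \<open>\<phi>\<close> gives integrability, because the law is a probability measure.\<close>

lemma is_pdf_integral:
  assumes Z: "Z \<in> borel_measurable M" and pdf: "is_pdf (distr M borel Z) g"
    and M: "prob_space M"
    and \<phi>: "(\<lambda>(U, V). \<phi> U V) \<in> borel_measurable borel" and bound: "\<And>U V. \<bar>\<phi> U V\<bar> \<le> (B::real)"
  shows "integrable lborel (\<lambda>(U, V). g U V * \<phi> U V)"
    and "(LINT (U, V)|lborel. g U V * \<phi> U V) = (\<integral>\<omega>. (case Z \<omega> of (U, V) \<Rightarrow> \<phi> U V) \<partial>M)"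
proof -
  interpret prob_space M by fact
  define g' \<phi>' where "g' = (\<lambda>(U, V). g U V)" and "\<phi>' = (\<lambda>(U, V). \<phi> U V)"
  have [measurable]: "g' \<in> borel_measurable borel" "\<phi>'
      \<in> borel_measurable borel" and nn: "\<And>p. 0 \<le> g' p"
    and eq: "distr M borel Z = density lborel (\<lambda>p. ennreal (g' p))"
    using pdf \<phi> by (auto simp: is_pdf_def g'_def \<phi>'_def split_beta')
  have prod: "(\<lambda>(U, V). g U V * \<phi> U V) = (\<lambda>p. g' p * \<phi>' p)"
    by (auto simp: g'_def \<phi>'_def)
  have bound': "\<bar>\<phi>' p\<bar> \<le> B" for p
    using bound by (simp add: \<phi>'_def split_beta)
  note [measurable] = Z
  have "integrable M (\<lambda>\<omega>. \<phi>' (Z \<omega>))"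
    using bound' by (intro integrable_const_bound[where B = B]) auto
  then have "integrable (distr M borel Z) \<phi>'"
    by (subst integrable_distr_eq) auto
  then show "integrable lborel (\<lambda>(U, V). g U V * \<phi> U V)"
    unfolding eq prod using nn by (subst (asm) integrable_real_density) auto
  have "(\<integral>\<omega>. \<phi>' (Z \<omega>) \<partial>M) = integral\<^sup>L (distr M borel Z) \<phi>'"
    by (subst integral_distr) auto
  also have "\<dots> = (LINT (U, V)|lborel. g U V * \<phi> U V)"
    unfolding eq prod using nn by (subst integral_real_density) auto
  finally show "(LINT (U, V)|lborel. g U V * \<phi> U V) = (\<integral>\<omega>. (case Z \<omega> of (U, V) \<Rightarrow> \<phi> U V) \<partial>M)"
    by (simp add: \<phi>'_def)
qed

text \<open>By \<open>is_pdf_integral\<close> the inner (U, V)-integral is an expectation over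
  realizations. This makes the outer integrands integrable although \<open>f\<close> is only given
  as a density for each (t, x, y) separately, and Fubini reduces the identity to single
  realizations.\<close>

lemma weak_transport_solution_pdf:
  assumes \<mu>: "prob_space \<mu>"
    and c: "\<And>x. (c1 has_real_derivative c1' x) (at x)" "\<And>x. (c2 has_real_derivative c2' x) (at x)"
    and c': "continuous_on UNIV c1'" "continuous_on UNIV c2'"
    and u: "\<And>\<omega>. \<omega> \<in> space \<mu> \<Longrightarrow> classical_solution1 c1 (\<lambda>x. u0 x \<omega>) (\<lambda>t x. u t x \<omega>)"
    and v: "\<And>\<omega>. \<omega> \<in> space \<mu> \<Longrightarrow> classical_solution1 c2 (\<lambda>x. v0 x \<omega>) (\<lambda>t x. v t x \<omega>)"
    and meas: "\<And>t x. 0 \<le> t \<Longrightarrow> u t x \<in> borel_measurable \<mu>"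
      "\<And>t x. 0 \<le> t \<Longrightarrow> v t x \<in> borel_measurable \<mu>"
    and f: "\<And>t x y. 0 \<le> t \<Longrightarrow> is_pdf (two_point_statistics \<mu> u v t x y) (f t x y)"
    and f0: "\<And>x y. (\<lambda>(U, V). f0 x y U V) \<in> borel_measurable borel"
      "\<And>x y. AE (U, V) in lborel. f 0 x y U V = f0 x y U V"
  shows "weak_transport_solution c1 c2 f0 f"
  unfolding weak_transport_solution_def Let_def
proof (intro allI impI)
  interpret prob_space \<mu> by fact
  interpret pair: pair_sigma_finite \<mu> "lborel :: (real \<times> real \<times> real) measure" ..
  interpret pair2: pair_sigma_finite \<mu> "lborel :: (real \<times> real) measure" ..
  fix \<psi> assume test: "test_function \<psi>"
  obtain \<psi>' R where \<psi>': "continuous_on UNIV \<psi>'" "\<And>p. (\<psi> has_derivative blinfun_apply (\<psi>' p)) (at p)"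
    and R: "0 \<le> R" "\<And>p. R < norm p \<Longrightarrow> \<psi> p = 0" "\<And>p. R < norm p \<Longrightarrow> \<psi>' p = 0"
    using test_function_derivative[OF test] by metis
  define A where "A = (\<lambda>(t, x, y, U, V). adjoint_transport c1 c2 \<psi> t x y U V)"
  have A: "adjoint_transport c1 c2 \<psi> t x y U V = A (t, x, y, U, V)" for t x y U V
    by (simp add: A_def)
  have cont_A: "continuous_on UNIV A"
    unfolding A_def by (rule continuous_on_adjoint_transport[OF \<psi>' c c'])
  have cont_\<psi>: "continuous_on UNIV \<psi>"
    using has_derivative_continuous_on[OF \<psi>'(2)] by auto
  have supp_A: "A p = 0" if "R < norm p" for p
    using R(2,3)[OF that] by (auto simp: A_def adjoint_transport_eq[OF \<psi>'(2) c] split: prod.split)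
  have bounded: "\<exists>B. \<forall>p. \<bar>g p\<bar> \<le> B"
    if "continuous_on UNIV g" "\<And>p. R < norm p \<Longrightarrow> g p = 0"
        for g :: "real \<times> real \<times> real \<times> real \<times> real \<Rightarrow> real"
  proof -
    have "bounded (g ` cball 0 R)"
      using that(1) by (intro compact_imp_bounded compact_continuous_image)
          (auto intro: continuous_on_subset)
    then obtain B where B: "0 < B" "\<And>p. norm p \<le> R \<Longrightarrow> \<bar>g p\<bar> \<le> B"
      unfolding bounded_pos by auto
    have "\<bar>g p\<bar> \<le> B" for p
      using B that(2)[of p] by (cases "R < norm p") auto
    then show ?thesis by blast
  qed
  obtain BA where BA: "\<And>p. \<bar>A p\<bar> \<le> BA" using bounded[OF cont_A supp_A] by blast
  obtain B\<psi> where B\<psi>: "\<And>p. \<bar>\<psi> p\<bar> \<le> B\<psi>" using bounded[OF cont_\<psi> R(2)] by blast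
  note [measurable] = borel_measurable_continuous_onI[OF cont_A] borel_measurable_continuous_onI[OF cont_\<psi>]
  have pdf_integral:
    "integrable lborel (\<lambda>(U, V). f t x y U V * g (t, x, y, U, V))"
    "(LINT (U, V)|lborel. f t x y U V * g (t, x, y, U, V)) = (\<integral>\<omega>. g (t, x, y, u t x \<omega>, v t y \<omega>) \<partial>\<mu>)"
    if "0 \<le> t" "continuous_on UNIV g" "\<And>p. \<bar>g p\<bar> \<le> B"
        for t x y B and g :: "real \<times> real \<times> real \<times> real \<times> real \<Rightarrow> real"
  proof -
    have Z: "(\<lambda>\<omega>. (u t x \<omega>, v t y \<omega>)) \<in> borel_measurable \<mu>"
      using meas[OF that(1)] by (rule borel_measurable_Pair)
    have g: "(\<lambda>(U, V). g (t, x, y, U, V)) \<in> borel_measurable borel"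
      unfolding split_beta' by (intro borel_measurable_continuous_onI continuous_on_compose2[OF that(2)])
        (auto intro!: continuous_intros)
    note * = is_pdf_integral[OF Z f[OF that(1), unfolded two_point_statistics_def] \<mu> g, of B, OF that(3)]
    show "integrable lborel (\<lambda>(U, V). f t x y U V * g (t, x, y, U, V))" by (rule *(1))
    show "(LINT (U, V)|lborel. f t x y U V * g (t, x, y, U, V))
        = (\<integral>\<omega>. g (t, x, y, u t x \<omega>, v t y \<omega>) \<partial>\<mu>)"
      using *(2) by simp
  qed
  \<comment> \<open>\<open>f0\<close> agrees with the density at time 0 only almost everywhere, so
    its integrals are obtained from those of \<open>f 0\<close>.\<close>
  have f0_cong: "(AE (U, V) in lborel. f 0 x y U V * \<psi> (0, x, y, U, V) = f0 x y U V * \<psi> (0, x, y, U, V))" for x y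
    using f0(2)[of x y] by eventually_elim auto
  have f0_meas: "(\<lambda>(U, V). f0 x y U V * \<psi> (0, x, y, U, V)) \<in> borel_measurable lborel"
    "(\<lambda>(U, V). f 0 x y U V * \<psi> (0, x, y, U, V)) \<in> borel_measurable lborel" for x y
  proof -
    have "(\<lambda>p. \<psi> (0, x, y, p)) \<in> borel_measurable borel"
      by (intro borel_measurable_continuous_onI continuous_on_compose2[OF cont_\<psi>])
        (auto intro!: continuous_intros)
    then show "(\<lambda>(U, V). f0 x y U V * \<psi> (0, x, y, U, V)) \<in> borel_measurable lborel"
      "(\<lambda>(U, V). f 0 x y U V * \<psi> (0, x, y, U, V)) \<in> borel_measurable lborel"
      using f0(1)[of x y] f[of 0 x y] by (auto simp: is_pdf_def split_beta')
  qed
  have f0_integral: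
    "integrable lborel (\<lambda>(U, V). f0 x y U V * \<psi> (0, x, y, U, V))"
    "(LINT (U, V)|lborel. f0 x y U V * \<psi> (0, x, y, U, V)) = (\<integral>\<omega>. \<psi> (0, x, y, u 0 x \<omega>, v 0 y \<omega>) \<partial>\<mu>)"
        for x y
    using pdf_integral[OF order_refl cont_\<psi> B\<psi>, of x y] f0_cong[of x y] f0_meas[of x y]
      integrable_cong_AE[OF f0_meas(2,1), of x y x y] integral_cong_AE[OF f0_meas(2,1), of x y x y]
    by (simp_all add: split_beta')
  let ?S = "{0..} \<times> UNIV :: (real \<times> real \<times> real) set"
  have cont_uv: "continuous_on ({0..} \<times> UNIV) (\<lambda>(t, x). u t x \<omega>)"
      "continuous_on ({0..} \<times> UNIV) (\<lambda>(t, x). v t x \<omega>)"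
    if "\<omega> \<in> space \<mu>" for \<omega>
    using u[OF that] v[OF that] by (simp_all add: classical_solution1_def C1_on_imp_continuous_on)
  \<comment> \<open>Clamping time at 0 makes \<open>q\<close> measurable on all real times; on the
    half-space it is the graph map of the realization.\<close>
  define q where "q = (\<lambda>(\<omega>, t, x, y). (max 0 t, x, y, u (max 0 t) x \<omega>, v (max 0 t) y \<omega>))"
  have q: "q \<in> borel_measurable (\<mu> \<Otimes>\<^sub>M lborel)"
  proof -
    have 1: "(\<lambda>p. (fst p, fst (snd p), fst (snd (snd p))))
        \<in> \<mu> \<Otimes>\<^sub>M (lborel :: (real \<times> real \<times> real) measure) \<rightarrow>\<^sub>M \<mu> \<Otimes>\<^sub>M borel"
      "(\<lambda>p. (fst p, fst (snd p), snd (snd (snd p))))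
          \<in> \<mu> \<Otimes>\<^sub>M (lborel :: (real \<times> real \<times> real) measure) \<rightarrow>\<^sub>M \<mu> \<Otimes>\<^sub>M borel"
      unfolding lborel_prod[symmetric] borel_prod[symmetric] by measurable
    have [measurable]: "(\<lambda>p. u (max 0 (fst (snd p))) (fst (snd (snd p))) (fst p))
        \<in> borel_measurable (\<mu> \<Otimes>\<^sub>M (lborel :: (real \<times> real \<times> real) measure))"
      "(\<lambda>p. v (max 0 (fst (snd p))) (snd (snd (snd p))) (fst p))
          \<in> borel_measurable (\<mu> \<Otimes>\<^sub>M (lborel :: (real \<times> real \<times> real) measure))"
      using measurable_compose[OF 1(1) borel_measurable_Caratheodory[OF meas(1) cont_uv(1)]]
        measurable_compose[OF 1(2) borel_measurable_Caratheodory[OF meas(2) cont_uv(2)]]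
      by simp_all
    have [measurable]: "(\<lambda>p. fst (snd p))
        \<in> borel_measurable (\<mu> \<Otimes>\<^sub>M (lborel :: (real \<times> real \<times> real) measure))"
      "(\<lambda>p. fst (snd (snd p))) \<in> borel_measurable (\<mu> \<Otimes>\<^sub>M (lborel :: (real \<times> real \<times> real) measure))"
      "(\<lambda>p. snd (snd (snd p))) \<in> borel_measurable (\<mu> \<Otimes>\<^sub>M (lborel :: (real \<times> real \<times> real) measure))"
      unfolding lborel_prod[symmetric] by measurable
    show ?thesis
      unfolding q_def split_beta' by (intro borel_measurable_Pair) measurable
  qed
  \<comment> \<open>Restricted to t >= 0, since clamping may shrink the norm of a point with
    negative time.\<close>
  have norm_q: "norm p \<le> norm (q (\<omega>, p))" if "p \<in> ?S" for p \<omega>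
    using that by (auto simp: q_def norm_Pair split: prod.split)
  have S: "?S \<in> sets borel" by (intro borel_closed closed_Times) auto
  \<comment> \<open>The integrand is bounded by \<open>BA\<close> and vanishes off
    \<open>space \<mu>\<close> times a ball, a set of finite measure.\<close>
  have int_A: "integrable (\<mu> \<Otimes>\<^sub>M lborel) (\<lambda>(\<omega>, p). indicator ?S p * A (q (\<omega>, p)))"
  proof (rule integrableI_bounded_set[where A = "space \<mu> \<times> cball 0 R" and B = BA])
    show "space \<mu> \<times> cball 0 R \<in> sets (\<mu> \<Otimes>\<^sub>M (lborel :: (real \<times> real \<times> real) measure))" by simp
    show "(\<lambda>(\<omega>, p). indicator ?S p * A (q (\<omega>, p))) \<in> borel_measurable (\<mu> \<Otimes>\<^sub>M lborel)"
      using S q by measurable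
    show "emeasure (\<mu> \<Otimes>\<^sub>M lborel) (space \<mu> \<times> cball (0 :: real \<times> real \<times> real) R) < \<infinity>"
      using emeasure_lborel_cball_finite by
          (simp add: lborel.emeasure_pair_measure_Times emeasure_space_1)
    show "AE z in \<mu> \<Otimes>\<^sub>M lborel. z \<in> space \<mu> \<times> cball 0 R
        \<longrightarrow> norm (case z of (\<omega>, p) \<Rightarrow> indicator ?S p * A (q (\<omega>, p))) \<le> BA"
      using BA order_trans[OF abs_ge_zero BA] by (intro AE_I2)
          (auto simp: indicator_def split: prod.split)
    show "AE z in \<mu> \<Otimes>\<^sub>M lborel. z \<notin> space \<mu> \<times> cball 0 R
        \<longrightarrow> (case z of (\<omega>, p) \<Rightarrow> indicator ?S p * A (q (\<omega>, p))) = 0"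
    proof (intro AE_I2 impI)
      fix z assume "z \<in> space (\<mu> \<Otimes>\<^sub>M (lborel :: (real \<times> real \<times> real) measure))"
          "z \<notin> space \<mu> \<times> cball 0 R"
      then obtain \<omega> p where "z = (\<omega>, p)" "R < norm p"
        by (cases z) (auto simp: space_pair_measure)
      then show "(case z of (\<omega>, p) \<Rightarrow> indicator ?S p * A (q (\<omega>, p))) = 0"
        using supp_A[of "q (\<omega>, p)"] norm_q[of p \<omega>] by (cases "p \<in> ?S") auto
    qed
  qed
  define J where "J = (\<lambda>(t, x, y). LINT (U, V)|lborel. f t x y U V * A (t, x, y, U, V))"
  define J0 where "J0 = (\<lambda>(x, y). LINT (U, V)|lborel. f0 x y U V * \<psi> (0, x, y, U, V))"
  \<comment> \<open>For t < 0 the indicator makes both sides 0; elsewhere the inner integral is the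
    expectation of \<open>A\<close> along the graph.\<close>
  have J: "indicator ?S p *\<^sub>R J p = (\<integral>\<omega>. indicator ?S p * A (q (\<omega>, p)) \<partial>\<mu>)" for p
    using pdf_integral(2)[OF _ cont_A BA]
    by (cases p) (auto simp: J_def q_def indicator_def max_def)
  have intJ: "set_integrable lborel ?S J"
    unfolding set_integrable_def J using pair.integrable_snd[OF int_A] by simp
  \<comment> \<open>The graph map at the initial time, for the boundary term.\<close>
  define q0 where "q0 = (\<lambda>(\<omega>, x, y). q (\<omega>, 0, x, y))"
  have q0: "q0 \<in> borel_measurable (\<mu> \<Otimes>\<^sub>M lborel)"
  proof -
    have "(\<lambda>p. (fst p, 0, snd p)) \<in> \<mu> \<Otimes>\<^sub>M lborel \<rightarrow>\<^sub>M \<mu> \<Otimes>\<^sub>M (lborel :: (real \<times> real \<times> real) measure)"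
      unfolding lborel_prod[symmetric] by measurable
    from measurable_compose[OF this q] show ?thesis by (simp add: q0_def split_beta')
  qed
  have norm_q0: "norm p \<le> norm (q0 (\<omega>, p))" for p \<omega>
    by (auto simp: q0_def q_def norm_Pair split: prod.split)
  have int_\<psi>: "integrable (\<mu> \<Otimes>\<^sub>M lborel) (\<lambda>(\<omega>, p). \<psi> (q0 (\<omega>, p)))"
  proof (rule integrableI_bounded_set[where A = "space \<mu> \<times> cball 0 R" and B = B\<psi>])
    show "space \<mu> \<times> cball 0 R \<in> sets (\<mu> \<Otimes>\<^sub>M (lborel :: (real \<times> real) measure))" by simp
    show "(\<lambda>(\<omega>, p). \<psi> (q0 (\<omega>, p))) \<in> borel_measurable (\<mu> \<Otimes>\<^sub>M lborel)"
      using q0 by measurable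
    show "emeasure (\<mu> \<Otimes>\<^sub>M lborel) (space \<mu> \<times> cball (0 :: real \<times> real) R) < \<infinity>"
      using emeasure_lborel_cball_finite by
          (simp add: lborel.emeasure_pair_measure_Times emeasure_space_1)
    show "AE z in \<mu> \<Otimes>\<^sub>M lborel. z \<in> space \<mu> \<times> cball 0 R
        \<longrightarrow> norm (case z of (\<omega>, p) \<Rightarrow> \<psi> (q0 (\<omega>, p))) \<le> B\<psi>"
      using B\<psi> by (intro AE_I2) (auto split: prod.split)
    show "AE z in \<mu> \<Otimes>\<^sub>M lborel. z \<notin> space \<mu> \<times> cball 0 R \<longrightarrow> (case z of (\<omega>, p) \<Rightarrow> \<psi> (q0 (\<omega>, p))) = 0"
    proof (intro AE_I2 impI)
      fix z assume "z \<in> space (\<mu> \<Otimes>\<^sub>M (lborel :: (real \<times> real) measure))" "z \<notin> space \<mu> \<times> cball 0 R"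
      then obtain \<omega> p where "z = (\<omega>, p)" "R < norm p"
        by (cases z) (auto simp: space_pair_measure)
      then show "(case z of (\<omega>, p) \<Rightarrow> \<psi> (q0 (\<omega>, p))) = 0"
        using R(2)[of "q0 (\<omega>, p)"] norm_q0[of p \<omega>] by simp
    qed
  qed
  have J0: "J0 = (\<lambda>p. \<integral>\<omega>. \<psi> (q0 (\<omega>, p)) \<partial>\<mu>)"
    using f0_integral(2) by (auto simp: J0_def q0_def q_def)
  have intJ0: "integrable lborel J0"
    unfolding J0 using pair2.integrable_snd[OF int_\<psi>] by simp
  have "(LINT p:?S|lborel. J p) = (\<integral>\<omega>. (LINT p:?S|lborel. A (q (\<omega>, p))) \<partial>\<mu>)"
    unfolding set_lebesgue_integral_def J using pair.Fubini_integral[OF int_A] by simp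
  also have "\<dots> = (\<integral>\<omega>. - (LINT p|lborel. \<psi> (q0 (\<omega>, p))) \<partial>\<mu>)"
  \<comment> \<open>For each realization this is the deterministic integration by parts; at t = 0
    the solution takes its initial values.\<close>
  proof (rule Bochner_Integration.integral_cong[OF refl])
    fix \<omega> assume \<omega>: "\<omega> \<in> space \<mu>"
    have "(LINT p:?S|lborel. A (q (\<omega>, p))) =
      (LINT (t, x, y):?S|lborel. adjoint_transport c1 c2 \<psi> t x y (u t x \<omega>) (v t y \<omega>))"
      using S by (intro set_lebesgue_integral_cong) (auto simp: A_def q_def max_def)
    also have "\<dots> = - (LINT (x, y)|lborel. \<psi> (0, x, y, u0 x \<omega>, v0 y \<omega>))"
      by (rule integral_adjoint_transport_along_solutions[OF test c c' u[OF \<omega>] v[OF \<omega>]])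
    also have "(LINT (x, y)|lborel. \<psi> (0, x, y, u0 x \<omega>, v0 y \<omega>)) = (LINT p|lborel. \<psi> (q0 (\<omega>, p)))"
      using u[OF \<omega>] v[OF \<omega>]
      by (intro Bochner_Integration.integral_cong) (auto simp: q0_def q_def classical_solution1_def)
    finally show "(LINT p:?S|lborel. A (q (\<omega>, p))) = - (LINT p|lborel. \<psi> (q0 (\<omega>, p)))" .
  qed
  also have "\<dots> = - (LINT p|lborel. J0 p)"
    unfolding J0 using pair2.Fubini_integral[OF int_\<psi>] by simp
  finally have sum: "(LINT p:?S|lborel. J p) + (LINT p|lborel. J0 p) = 0" by simp
  show "(\<forall>t\<ge>0. \<forall>x y. integrable lborel (\<lambda>(U, V). f t x y U V * adjoint_transport c1 c2 \<psi> t x y U V)) \<and>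
    (\<forall>x y. integrable lborel (\<lambda>(U, V). f0 x y U V * \<psi> (0, x, y, U, V))) \<and>
    set_integrable lborel ?S (\<lambda>(t, x, y). LINT (U, V)|lborel. f t x y U V * adjoint_transport c1 c2 \<psi> t x y U V) \<and>
    integrable lborel (\<lambda>(x, y). LINT (U, V)|lborel. f0 x y U V * \<psi> (0, x, y, U, V)) \<and>
    (LINT p:?S|lborel. (\<lambda>(t, x, y). LINT (U, V)|lborel. f t x y U V * adjoint_transport c1 c2 \<psi> t x y U V) p) +
    (LINT p|lborel. (\<lambda>(x, y). LINT (U, V)|lborel. f0 x y U V * \<psi> (0, x, y, U, V)) p) = 0"
    using intJ intJ0 pdf_integral(1)[OF _ cont_A BA] f0_integral(1) sum
    unfolding A J_def J0_def by (intro conjI allI impI)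
qed

section \<open>Regularity of the speeds and conclusion\<close>

lemma smooth_entries_imp_C1_conjugate_entry:
  fixes D :: "real \<Rightarrow> real^2^2"
  assumes "\<And>i j. smooth (\<lambda>x. D x $ i $ j)"
  shows "\<exists>c'. (\<forall>x. ((\<lambda>x. (P ** D x ** Q) $ k $ l) has_real_derivative c' x)
      (at x)) \<and> continuous_on UNIV c'"
proof -
  have d: "((\<lambda>x. D x $ i $ j) has_real_derivative deriv (\<lambda>x. D x $ i $ j) x) (at x)" for i j x
  proof -
    have "((deriv ^^ 0) (\<lambda>x. D x $ i $ j)) differentiable (at x)"
      using assms unfolding smooth_def by blast
    then show ?thesis by (simp only: funpow_0 DERIV_deriv_iff_real_differentiable)
  qed
  have c: "continuous_on UNIV (deriv (\<lambda>x. D x $ i $ j))" for i j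
  proof -
    \<comment> \<open>The case n = 1 of \<open>smooth\<close>: the first derivative is itself
      differentiable, hence continuous.\<close>
    have "((deriv ^^ 1) (\<lambda>x. D x $ i $ j)) differentiable (at x)" for x
      using assms unfolding smooth_def by blast
    then have "isCont (deriv (\<lambda>x. D x $ i $ j)) x" for x
      by (intro differentiable_imp_continuous_within)
          (simp only: funpow.simps One_nat_def comp_apply id_apply)
    then show ?thesis by (intro continuous_at_imp_continuous_on ballI)
  qed
  \<comment> \<open>A combination of the entries of \<open>D x\<close> with coefficients independent
    of x, so it inherits their C1 regularity.\<close>
  have eq: "(P ** D x ** Q) $ k $ l = (\<Sum>j\<in>UNIV. (\<Sum>i\<in>UNIV. P $ k $ i * D x $ i $ j) * Q $ j $ l)"
      for x
    by (simp add: matrix_matrix_mult_def)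
  show ?thesis
  proof (intro exI conjI allI)
    show "((\<lambda>x. (P ** D x ** Q) $ k $ l) has_real_derivative
      (\<Sum>j\<in>UNIV. (\<Sum>i\<in>UNIV. P $ k $ i * deriv (\<lambda>x. D x $ i $ j) x) * Q $ j $ l)) (at x)" for x
      unfolding eq by (intro DERIV_sum DERIV_cmult DERIV_cmult_right d)
    show "continuous_on UNIV (\<lambda>x. \<Sum>j\<in>UNIV. (\<Sum>i\<in>UNIV. P $ k $ i * deriv (\<lambda>x. D x $ i $ j) x) * Q $ j $ l)"
      by (intro continuous_on_sum continuous_on_mult continuous_on_const c)
  qed
qed

theorem theorem4p2:
  fixes \<Omega> :: "(real^'d) set" and \<mu> :: "(real^'d) measure"
    and D :: "real \<Rightarrow> real^2^2" and P :: "real^2^2" and c1 c2 :: "real \<Rightarrow> real"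
    and u0 v0 :: "real \<Rightarrow> real^'d \<Rightarrow> real"
    and u v :: "real \<Rightarrow> real \<Rightarrow> real^'d \<Rightarrow> real"
    and f :: "real \<Rightarrow> real \<Rightarrow> real \<Rightarrow> real \<Rightarrow> real \<Rightarrow> real"
    and f0 :: "real \<Rightarrow> real \<Rightarrow> real \<Rightarrow> real \<Rightarrow> real"
  assumes prob: "prob_space \<mu>" "sets \<mu> = sets (restrict_space borel \<Omega>)"
    and D_smooth: "\<And>i j. smooth (\<lambda>x. D x $ i $ j)"
    and P_invertible: "invertible P"
    and diagonalization: "\<And>x. P ** D x ** matrix_inv P = diag2 (c1 x) (c2 x)"
    and data_measurable: "\<And>x. u0 x \<in> borel_measurable \<mu>" "\<And>x. v0 x \<in> borel_measurable \<mu>"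
    and u_solution: "\<And>\<omega>. \<omega> \<in> \<Omega> \<Longrightarrow> classical_solution1 c1 (\<lambda>x. u0 x \<omega>) (\<lambda>t x. u t x \<omega>)"
    and v_solution: "\<And>\<omega>. \<omega> \<in> \<Omega> \<Longrightarrow> classical_solution1 c2 (\<lambda>x. v0 x \<omega>) (\<lambda>t x. v t x \<omega>)"
    and solution_measurable:
      "\<And>t x. t \<ge> 0 \<Longrightarrow> u t x \<in> borel_measurable \<mu>"
      "\<And>t x. t \<ge> 0 \<Longrightarrow> v t x \<in> borel_measurable \<mu>"
    and f_pdf: "\<And>t x y. t \<ge> 0 \<Longrightarrow> is_pdf (two_point_statistics \<mu> u v t x y) (f t x y)"
    and f0_L1: "\<And>x y. integrable lborel (\<lambda>(U, V). f0 x y U V)"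
    and f_initial: "\<And>x y. AE (U, V) in lborel. f 0 x y U V = f0 x y U V"
  shows
    \<comment> \<open>pointwise, for all \<open>t \<ge> 0\<close>, \<open>(x, y)\<close>, wherever \<open>f\<close> is differentiable in \<open>(t, x, y)\<close>\<close>
    "(\<forall>t\<ge>0. \<forall>x y. AE (U, V) in lborel.
        (\<lambda>(s, a, b). f s a b U V) differentiable (at (t, x, y) within {0..} \<times> UNIV) \<longrightarrow>
        transport_eq_at c1 c2 (\<lambda>s a b. f s a b U V) t x y) \<and>
     \<comment> \<open>classical solutions, with one null set of \<open>(U, V)\<close> for all \<open>(t, x, y)\<close>\<close>
     (AE (U, V) in lborel.
        C1_on ({0..} \<times> UNIV) (\<lambda>(s, a, b). f s a b U V) \<longrightarrow>
        (\<forall>t\<ge>0. \<forall>x y. transport_eq_at c1 c2 (\<lambda>s a b. f s a b U V) t x y)) \<and>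
     \<comment> \<open>without any regularity of \<open>f\<close>: in the sense of distributions\<close>
     weak_transport_solution c1 c2 f0 f \<and>
     (\<forall>x y. AE (U, V) in lborel. f 0 x y U V = f0 x y U V)"
proof (intro conjI)
  have space: "space \<mu> = \<Omega>"
    using sets_eq_imp_space_eq[OF prob(2)] by (simp add: space_restrict_space)
  \<comment> \<open>The speeds are the diagonal entries of the conjugated matrix; this is how the
    smoothness of \<open>D\<close> reaches \<open>c1\<close> and \<open>c2\<close>.\<close>
  have c_eq: "c1 = (\<lambda>x. (P ** D x ** matrix_inv P) $ 1 $ 1)" "c2
      = (\<lambda>x. (P ** D x ** matrix_inv P) $ 2 $ 2)"
    unfolding diagonalization by (simp_all add: diag2_def vector_2)
  obtain c1' where c1: "\<And>x. (c1 has_real_derivative c1' x) (at x)" "continuous_on UNIV c1'"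
    using smooth_entries_imp_C1_conjugate_entry[OF D_smooth, of P "matrix_inv P" 1 1, folded c_eq] by metis
  obtain c2' where c2: "\<And>x. (c2 has_real_derivative c2' x) (at x)" "continuous_on UNIV c2'"
    using smooth_entries_imp_C1_conjugate_entry[OF D_smooth, of P "matrix_inv P" 2 2, folded c_eq] by metis
  have c: "continuous_on UNIV c1" "continuous_on UNIV c2"
    using DERIV_continuous_on[OF c1(1)] DERIV_continuous_on[OF c2(1)] by auto
  \<comment> \<open>Shared by both pointwise claims: the first uses it at a single point, the second
    at all rational points.\<close>
  have dir: "AE (U, V) in lborel. \<forall>F'.
      ((\<lambda>(s, a, b). f s a b U V) has_derivative F') (at (t, x, y) within {0..} \<times> UNIV) \<longrightarrow>
      F' (1, c1 x, c2 y) = 0" if "0 \<le> t" for t x y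
    by (rule AE_pdf_transport_direction[where \<mu> = \<mu> and u = u and v = v and ?u0.0 = u0 and ?v0.0 = v0])
      (use u_solution v_solution c f_pdf that space in auto)
  show "\<forall>t\<ge>0. \<forall>x y. AE (U, V) in lborel.
      (\<lambda>(s, a, b). f s a b U V) differentiable (at (t, x, y) within {0..} \<times> UNIV) \<longrightarrow>
      transport_eq_at c1 c2 (\<lambda>s a b. f s a b U V) t x y"
  proof (intro allI impI)
    fix t x y :: real assume t: "0 \<le> t"
    show "AE (U, V) in lborel.
      (\<lambda>(s, a, b). f s a b U V) differentiable (at (t, x, y) within {0..} \<times> UNIV) \<longrightarrow>
      transport_eq_at c1 c2 (\<lambda>s a b. f s a b U V) t x y"
      using dir[OF t, of x y] 
      by eventually_elim (auto simp: differentiable_def intro: transport_eq_atI[OF t])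
  qed
  show "AE (U, V) in lborel. C1_on ({0..} \<times> UNIV) (\<lambda>(s, a, b). f s a b U V) \<longrightarrow>
      (\<forall>t\<ge>0. \<forall>x y. transport_eq_at c1 c2 (\<lambda>s a b. f s a b U V) t x y)"
    by (rule AE_pdf_transport_C1[OF c dir])
  show "weak_transport_solution c1 c2 f0 f"
  proof (rule weak_transport_solution_pdf[where u = u and v = v and \<mu> = \<mu> and c1' = c1' and c2' = c2'])
    \<comment> \<open>Integrability of \<open>f0\<close> enters through the measurability that it
      contains.\<close>
    show "(\<lambda>(U, V). f0 x y U V) \<in> borel_measurable borel" for x y
      using borel_measurable_integrable[OF f0_L1, of x y] by simp
  qed (use prob(1) c1 c2 u_solution v_solution solution_measurable f_pdf f_initial space in auto)
  show "\<forall>x y. AE (U, V) in lborel. f 0 x y U V = f0 x y U V"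
    using f_initial by blast
qed

end
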